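(* Let $G$ be a group. If $G$ is locally nil-rigid on $\mathfrak{C}_2$ (every finitely generated subgroup of $G$ is nil-rigid on $\mathfrak{C}_2$), or locally nil-rigid on $\mathfrak{C}_4$ (every finitely generated subgroup of $G$ is nil-rigid on $\mathfrak{C}_4$), then $G$ is nil-rigid on $\mathfrak{C}_4$. The same conclusion holds if $G$ is locally nil-rigid on $\mathfrak{C}_3$ and locally residually finite (every finitely generated subgroup of $G$ is nil-rigid on $\mathfrak{C}_3$ and residually finite).
   Context: All groups are discrete. **Pointed systems.** A pointed dynamical system $(G,X)$ consists of a group $G$, a compact metric space $(X,d_X)$, a continuous left action of $G$ on $X$, and a point $0\in X$ with $g\cdot 0=0$ for all $g\in G$. It is expansive if there is $0<\Delta\le1$ such that $d_X(g\cdot x,g\cdot y)\le\Delta$ for all $g\in G$ implies $x=y$. A point $x\in X$ is homoclinic in $(G,X)$ if for every $\epsilon>0$ there is a finite $E\subseteq G$ with $d_X(g\cdot x,0)<\epsilon$ for all $g\in G\setminus E$. For $A,E\subseteq G$ let $\partial_EA=\{g\in A: Eg\not\subseteq A\}$. A designation in $(G,X)$ is a family $(A_i,x_i)_{i\in I}$ with $x_i\in X$ and $(A_i)_{i\in I}$ a partition of $G$; it is a $(\delta,E)$-designation if $d_X(g\cdot x_i,0)<\delta$ for all $i\in I$, $g\in\partial_EA_i$. An $\epsilon$-realization of it is a point $y\in X$ with $d_X(g\cdot y,g\cdot x_i)<\epsilon$ whenever $g\in A_i$. **Tiered systems.** A tiered dynamical system (TDS) $\mathcal{X}=(X,(G_t,X_t)_{t\in\mathcal{T}},(\phi^{t'}_t)_{t\le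 t'})$ consists of: a compact metric space $X$ (the ambient space) with a special point $0$; a directed set $\mathcal{T}$ with least element $t_0$; for each $t\in\mathcal{T}$ an expansive pointed dynamical system $(G_t,X_t)$ with $0\in X_t\subseteq X$ (special point $0$, metric restricted from $X$), where $X_t\subseteq X_{t'}$ whenever $t\le t'$; and for all $t\le t'$ a finite-to-one surjective homomorphism $\phi^{t'}_t:G_{t'}\to G_t$ with $\phi^t_t=\mathrm{id}$, $\phi^{t'}_t\circ\phi^{t''}_{t'}=\phi^{t''}_t$ for $t\le t'\le t''$, and $\phi^{t'}_t(g)\cdot x=g\cdot x$ for all $x\in X_t$, $g\in G_{t'}$. Its base group is $G_{t_0}$. The indices $t$ (or the sets $X_t$) are called tiers. An evolution of $\mathcal{X}$ is a continuous $f:X\to X$ such that for all $t\le t'$ and $x\in X_t$, if $f(x)\in X_{t'}$ then $f(\phi^{t'}_t(g)\cdot x)=g\cdot f(x)$ for all $g\in G_{t'}$. The pair $(\mathcal{X},f)$ is called an ETDS. **Properties.** $\mathcal{X}$ is $f$-stabilizing if for every $t$ there is $s(t)\ge t$ with $f^k(X_t)\subseteq X_{s(t)}$ for all $k\in\mathbb{N}$. $\mathcal{X}$ is weakly $0$-gluing if for every $t$ there is $w(t)\ge t$ such that for all $\epsilon>0$ there exist $\delta>0$ and a finite $E\subseteq G_{w(t)}$ such that every $(\delta,E)$-designation $(A_i,x_i)_{i\in I}$ in $(G_{w(t)},X_{w(t)})$ with all $x_i\in X_t$ has an $\epsilon$-realization in $X_{w(t)}$. $\mathcal{X}$ has weakly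 dense homoclinic points if for all $t$, $x\in X_t$, $\epsilon>0$ there are $t'\ge t$ and $y\in X_{t'}$, homoclinic in $(G_{t'},X_{t'})$, with $d_X(x,y)<\epsilon$. **Classes.** $\mathfrak{C}_2$ is the class of ETDSs $(\mathcal{X},f)$ such that $\mathcal{X}$ is $f$-stabilizing, weakly $0$-gluing and has weakly dense homoclinic points. $\mathfrak{C}_3$ is the class of those $(\mathcal{X},f)\in\mathfrak{C}_2$ for which every group $G_t$ is residually finite. $\mathfrak{C}_4$ is the class of those $(\mathcal{X},f)\in\mathfrak{C}_2$ for which $\mathcal{X}$ has a single tier. **Nil-rigidity.** An evolution $f$ is asymptotically nilpotent if $\lim_{n\to\infty}f^n(x)=0$ for all $x$ in the ambient space $X$, and nilpotent on $Y\subseteq X$ if there is $n\in\mathbb{N}$ with $f^n(x)=0$ for all $x\in Y$. A group $G$ is nil-rigid on a class $\mathfrak{C}$ of ETDSs if for every $(\mathcal{X},f)\in\mathfrak{C}$ with base group $G$ and $f$ asymptotically nilpotent, $f$ is nilpotent on each tier $X_t$. *)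

theory Defs
  imports
    "HOL-Analysis.Analysis"
    "HOL-Algebra.Generated_Groups"
    "HOL-Algebra.Group_Action"
begin

section \<open>Group-theoretic notions\<close>

definition residually_finite :: "'g monoid \<Rightarrow> bool" where
  "residually_finite G \<longleftrightarrow>
     (\<forall>g\<in>carrier G. g \<noteq> \<one>\<^bsub>G\<^esub> \<longrightarrow>
        (\<exists>N. normal N G \<and> finite (carrier (G Mod N)) \<and> g \<notin> N))"

definition fg_subgroup :: "'g set \<Rightarrow> 'g monoid \<Rightarrow> bool" where
  "fg_subgroup H G \<longleftrightarrow> (\<exists>S. finite S \<and> S \<subseteq> carrier G \<and> H = generate G S)"

definition locally_group :: "('g monoid \<Rightarrow> bool) \<Rightarrow> 'g monoid \<Rightarrow> bool" where
  "locally_group P G \<longleftrightarrow> (\<forall>H. fg_subgroup H G \<longrightarrow> P (G\<lparr>carrier := H\<rparr>))"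


section \<open>Pointed dynamical systems\<close>

locale pointed_system = Metric_space X d + group_action G X act
  for X :: "'x set" and d :: "'x \<Rightarrow> 'x \<Rightarrow> real" and z :: 'x
    and G :: "'h monoid" and act :: "'h \<Rightarrow> 'x \<Rightarrow> 'x" +
  assumes compact: "compact_space mtopology"
    and continuous: "\<And>g. g \<in> carrier G \<Longrightarrow> continuous_map mtopology mtopology (act g)"
    and zero_in: "z \<in> X"
    and zero_fixed: "\<And>g. g \<in> carrier G \<Longrightarrow> act g z = z"

definition expansive ::
  "'x set \<Rightarrow> ('x \<Rightarrow> 'x \<Rightarrow> real) \<Rightarrow> 'h monoid \<Rightarrow> ('h \<Rightarrow> 'x \<Rightarrow> 'x) \<Rightarrow> bool" where
  "expansive X d G act \<longleftrightarrow>
     (\<exists>\<Delta>. 0 < \<Delta> \<and> \<Delta> \<le> 1 \<and>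
        (\<forall>x\<in>X. \<forall>y\<in>X. (\<forall>g\<in>carrier G. d (act g x) (act g y) \<le> \<Delta>) \<longrightarrow> x = y))"

definition homoclinic ::
  "('x \<Rightarrow> 'x \<Rightarrow> real) \<Rightarrow> 'x \<Rightarrow> 'h monoid \<Rightarrow> ('h \<Rightarrow> 'x \<Rightarrow> 'x) \<Rightarrow> 'x \<Rightarrow> bool" where
  "homoclinic d z G act x \<longleftrightarrow>
     (\<forall>\<epsilon>>0. \<exists>E. finite E \<and> E \<subseteq> carrier G \<and> (\<forall>g\<in>carrier G - E. d (act g x) z < \<epsilon>))"

definition group_boundary :: "'h monoid \<Rightarrow> 'h set \<Rightarrow> 'h set \<Rightarrow> 'h set" where
  "group_boundary G E A = {g \<in> A. \<not> (\<lambda>e. e \<otimes>\<^bsub>G\<^esub> g) ` E \<subseteq> A}"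

definition designation ::
  "'x set \<Rightarrow> 'h monoid \<Rightarrow> 'i set \<Rightarrow> ('i \<Rightarrow> 'h set) \<Rightarrow> ('i \<Rightarrow> 'x) \<Rightarrow> bool" where
  "designation X G I A x \<longleftrightarrow>
     (\<forall>i\<in>I. x i \<in> X) \<and> disjoint_family_on A I \<and> (\<Union>i\<in>I. A i) = carrier G"

definition small_designation ::
  "'x set \<Rightarrow> ('x \<Rightarrow> 'x \<Rightarrow> real) \<Rightarrow> 'x \<Rightarrow> 'h monoid \<Rightarrow> ('h \<Rightarrow> 'x \<Rightarrow> 'x) \<Rightarrow>
     real \<Rightarrow> 'h set \<Rightarrow> 'i set \<Rightarrow> ('i \<Rightarrow> 'h set) \<Rightarrow> ('i \<Rightarrow> 'x) \<Rightarrow> bool" where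
  "small_designation X d z G act \<delta> E I A x \<longleftrightarrow>
     designation X G I A x \<and>
     (\<forall>i\<in>I. \<forall>g\<in>group_boundary G E (A i). d (act g (x i)) z < \<delta>)"

definition realization ::
  "'x set \<Rightarrow> ('x \<Rightarrow> 'x \<Rightarrow> real) \<Rightarrow> ('h \<Rightarrow> 'x \<Rightarrow> 'x) \<Rightarrow>
     real \<Rightarrow> 'i set \<Rightarrow> ('i \<Rightarrow> 'h set) \<Rightarrow> ('i \<Rightarrow> 'x) \<Rightarrow> 'x \<Rightarrow> bool" where
  "realization X d act \<epsilon> I A x y \<longleftrightarrow>
     y \<in> X \<and> (\<forall>i\<in>I. \<forall>g\<in>A i. d (act g y) (act g (x i)) < \<epsilon>)"


section \<open>Tiered dynamical systems\<close>

text \<open>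
  The pair \<open>(t, t')\<close> belongs to \<open>tle\<close> iff \<open>t \<le> t'\<close>, and \<open>tmap t' t\<close> is the homomorphism
  from the group of the higher tier \<open>t'\<close> onto that of the lower tier \<open>t\<close>.
  The metric \<open>tdist\<close> is only meaningful on \<open>ambient\<close>, and \<open>tact t g\<close> only on \<open>tspace t\<close>.
\<close>

record ('x, 't, 'h) tds =
  ambient :: "'x set"
  tdist :: "'x \<Rightarrow> 'x \<Rightarrow> real"
  tzero :: 'x
  tiers :: "'t set"
  tle :: "('t \<times> 't) set"
  tbase :: 't
  tgroup :: "'t \<Rightarrow> 'h monoid"
  tspace :: "'t \<Rightarrow> 'x set"
  tact :: "'t \<Rightarrow> 'h \<Rightarrow> 'x \<Rightarrow> 'x"
  tmap :: "'t \<Rightarrow> 't \<Rightarrow> 'h \<Rightarrow> 'h"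

locale tiered_system =
  fixes S :: "('x, 't, 'h) tds"
  assumes ambient_metric: "Metric_space (ambient S) (tdist S)"
    and ambient_compact: "compact_space (Metric_space.mtopology (ambient S) (tdist S))"
    and zero_ambient: "tzero S \<in> ambient S"
    and tiers_preorder: "preorder_on (tiers S) (tle S)"
    and tiers_directed: "\<And>t u. \<lbrakk>t \<in> tiers S; u \<in> tiers S\<rbrakk> \<Longrightarrow>
      \<exists>v\<in>tiers S. (t, v) \<in> tle S \<and> (u, v) \<in> tle S"
    and base_in: "tbase S \<in> tiers S"
    and base_least: "\<And>t. t \<in> tiers S \<Longrightarrow> (tbase S, t) \<in> tle S"
    and tier_subset: "\<And>t. t \<in> tiers S \<Longrightarrow> tspace S t \<subseteq> ambient S"
    and tier_system: "\<And>t. t \<in> tiers S \<Longrightarrow>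
      pointed_system (tspace S t) (tdist S) (tzero S) (tgroup S t) (tact S t)"
    and tier_expansive: "\<And>t. t \<in> tiers S \<Longrightarrow>
      expansive (tspace S t) (tdist S) (tgroup S t) (tact S t)"
    and tier_mono: "\<And>t t'. (t, t') \<in> tle S \<Longrightarrow> tspace S t \<subseteq> tspace S t'"
    and tmap_hom: "\<And>t t'. (t, t') \<in> tle S \<Longrightarrow> tmap S t' t \<in> hom (tgroup S t') (tgroup S t)"
    and tmap_surj: "\<And>t t'. (t, t') \<in> tle S \<Longrightarrow>
      tmap S t' t ` carrier (tgroup S t') = carrier (tgroup S t)"
    and tmap_finite_to_one: "\<And>t t' h. \<lbrakk>(t, t') \<in> tle S; h \<in> carrier (tgroup S t)\<rbrakk> \<Longrightarrow>
      finite {g \<in> carrier (tgroup S t'). tmap S t' t g = h}"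
    and tmap_id: "\<And>t g. \<lbrakk>t \<in> tiers S; g \<in> carrier (tgroup S t)\<rbrakk> \<Longrightarrow> tmap S t t g = g"
    and tmap_comp: "\<And>t t' t'' g.
      \<lbrakk>(t, t') \<in> tle S; (t', t'') \<in> tle S; g \<in> carrier (tgroup S t'')\<rbrakk> \<Longrightarrow>
      tmap S t' t (tmap S t'' t' g) = tmap S t'' t g"
    and tmap_act: "\<And>t t' g x.
      \<lbrakk>(t, t') \<in> tle S; g \<in> carrier (tgroup S t'); x \<in> tspace S t\<rbrakk> \<Longrightarrow>
      tact S t (tmap S t' t g) x = tact S t' g x"

definition ambient_top :: "('x, 't, 'h) tds \<Rightarrow> 'x topology" where
  "ambient_top S = Metric_space.mtopology (ambient S) (tdist S)"

definition evolution :: "('x, 't, 'h) tds \<Rightarrow> ('x \<Rightarrow> 'x) \<Rightarrow> bool" where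
  "evolution S f \<longleftrightarrow>
     continuous_map (ambient_top S) (ambient_top S) f \<and>
     (\<forall>t t'. (t, t') \<in> tle S \<longrightarrow>
        (\<forall>x\<in>tspace S t. f x \<in> tspace S t' \<longrightarrow>
           (\<forall>g\<in>carrier (tgroup S t'). f (tact S t (tmap S t' t g) x) = tact S t' g (f x))))"

definition stabilizing :: "('x, 't, 'h) tds \<Rightarrow> ('x \<Rightarrow> 'x) \<Rightarrow> bool" where
  "stabilizing S f \<longleftrightarrow>
     (\<forall>t\<in>tiers S. \<exists>s. (t, s) \<in> tle S \<and> (\<forall>k. (f ^^ k) ` tspace S t \<subseteq> tspace S s))"

text \<open>
  Designations are indexed here by sets of group elements. Empty parts of a designation impose
  no condition, and nonempty disjoint parts can be indexed by chosen elements of the group,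
  so this covers families over arbitrary index sets.
\<close>

definition weakly_gluing :: "('x, 't, 'h) tds \<Rightarrow> bool" where
  "weakly_gluing S \<longleftrightarrow>
     (\<forall>t\<in>tiers S. \<exists>w. (t, w) \<in> tle S \<and>
        (\<forall>\<epsilon>>0. \<exists>\<delta>>0. \<exists>E. finite E \<and> E \<subseteq> carrier (tgroup S w) \<and>
           (\<forall>(I :: 'h set) A x.
              small_designation (tspace S w) (tdist S) (tzero S) (tgroup S w) (tact S w) \<delta> E I A x \<and>
              (\<forall>i\<in>I. x i \<in> tspace S t) \<longrightarrow>
              (\<exists>y. realization (tspace S w) (tdist S) (tact S w) \<epsilon> I A x y))))"

definition weakly_dense_homoclinic :: "('x, 't, 'h) tds \<Rightarrow> bool" where
  "weakly_dense_homoclinic S \<longleftrightarrow>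
     (\<forall>t\<in>tiers S. \<forall>x\<in>tspace S t. \<forall>\<epsilon>>0.
        \<exists>t'. (t, t') \<in> tle S \<and>
          (\<exists>y\<in>tspace S t'.
             homoclinic (tdist S) (tzero S) (tgroup S t') (tact S t') y \<and> tdist S x y < \<epsilon>))"


section \<open>Classes of evolutions and nil-rigidity\<close>

type_synonym ('x, 't, 'h) etds = "('x, 't, 'h) tds \<times> ('x \<Rightarrow> 'x)"

definition class_C2 :: "('x, 't, 'h) etds set" where
  "class_C2 = {(S, f). tiered_system S \<and> evolution S f \<and>
     stabilizing S f \<and> weakly_gluing S \<and> weakly_dense_homoclinic S}"

definition class_C3 :: "('x, 't, 'h) etds set" where
  "class_C3 = {(S, f) \<in> class_C2. \<forall>t\<in>tiers S. residually_finite (tgroup S t)}"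

definition class_C4 :: "('x, 't, 'h) etds set" where
  "class_C4 = {(S, f) \<in> class_C2. tiers S = {tbase S}}"

definition asymptotically_nilpotent :: "('x, 't, 'h) tds \<Rightarrow> ('x \<Rightarrow> 'x) \<Rightarrow> bool" where
  "asymptotically_nilpotent S f \<longleftrightarrow>
     (\<forall>x\<in>ambient S. limitin (ambient_top S) (\<lambda>n. (f ^^ n) x) (tzero S) sequentially)"

definition nilpotent_on :: "('x, 't, 'h) tds \<Rightarrow> ('x \<Rightarrow> 'x) \<Rightarrow> 'x set \<Rightarrow> bool" where
  "nilpotent_on S f Y \<longleftrightarrow> (\<exists>n. \<forall>x\<in>Y. (f ^^ n) x = tzero S)"

text \<open>
  Having base group \<open>G\<close> is read up to isomorphism; this allows the group elements of the system
  to be drawn from a type other than that of \<open>G\<close>.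
\<close>

definition nil_rigid :: "('x, 't, 'h) etds set \<Rightarrow> 'g monoid \<Rightarrow> bool" where
  "nil_rigid C G \<longleftrightarrow>
     (\<forall>(S, f)\<in>C. tgroup S (tbase S) \<cong> G \<and> asymptotically_nilpotent S f \<longrightarrow>
        (\<forall>t\<in>tiers S. nilpotent_on S f (tspace S t)))"

text \<open>
  A HOL formula cannot quantify over types, so a hypothesis of nil-rigidity has to be stated over
  fixed types. The following ones lose no systems with a base group \<open>G\<close> drawn from \<open>'g\<close>:

  \<^item> Points: a compact metric space with dense sequence \<open>q\<close> is identified with a subset
    of \<open>nat \<Rightarrow> real\<close> by \<open>x \<mapsto> (\<lambda>n. d x (q n))\<close>, carrying the metric along.

  \<^item> Groups: every tier group maps finite-to-one onto the base group, so its carrier injects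
    into \<open>'g \<times> nat\<close>.

  \<^item> Indices: if an evolution in one of the classes fails to be nilpotent on the tier \<open>t\<close>, then
    it still does so after restricting the index set to a countable subset that contains \<open>t\<close> and
    the least index and is closed under choices of upper bounds, of the indices witnessing
    stabilization and gluing, and of those witnessing density of homoclinic points (for points
    from a countable dense subset of each tier and for rational \<open>\<epsilon>\<close>). The restricted system has
    the same ambient space and base group and lies in the same class.
\<close>

type_synonym 'g std_etds = "(nat \<Rightarrow> real, nat, 'g \<times> nat) etds"

end

theory Submission
  imports Defs "HOL-Algebra.Elementary_Groups"
begin

text \<open>
  Let \<open>(G, X)\<close> be the unique tier of a system in \<open>class_C4\<close>, and \<open>\<Delta>\<close> an expansivity constant.
  By expansivity and compactness, any continuous map on \<open>X\<close> has a finite memory: the image of a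
  point \<open>x\<close> is determined, up to a given error, by the approximate position of finitely many
  translates of \<open>x\<close> (\<open>expansive_local_rule\<close>). Two finite sets are taken from this and from gluing:
  a memory set \<open>F\<close> of the evolution \<open>f\<close> for the error \<open>\<Delta> / 4\<close>, and a set \<open>E\<^sub>0\<close> that governs gluing
  up to the error \<open>\<Delta> / 4\<close>. Let \<open>H\<close> be the subgroup generated by both, and \<open>XH\<close> the closed set of
  points \<open>x\<close> that are supported on \<open>H\<close>, that is, for which \<open>g \<cdot> x\<close> is within \<open>\<Delta> / 4\<close> of \<open>0\<close> for all
  \<open>g\<close> outside \<open>H\<close>.

  Since \<open>F \<subseteq> H\<close>, the map \<open>f\<close> treats every coset \<open>H g\<close> separately, and so it maps \<open>XH\<close> to itself.
  Two points of \<open>XH\<close> are always close outside \<open>H\<close>, hence \<open>H\<close> alone acts expansively on \<open>XH\<close>.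
  Since \<open>E\<^sub>0 \<subseteq> H\<close>, the boundaries of \<open>H\<close> and of its complement with respect to \<open>E\<^sub>0\<close> are empty, so
  any point on \<open>H\<close> can be glued with \<open>0\<close> on the complement. This has two uses.

  \<^item> Gluing and density of homoclinic points pass from \<open>(G, X)\<close> to \<open>(H, XH)\<close>. Gluing over \<open>G\<close> is
    only available at the fixed scale \<open>\<Delta> / 4\<close>, because at a smaller scale the set governing it need
    not lie in \<open>H\<close>; expansivity of \<open>(H, XH)\<close> turns closeness at the scale \<open>\<Delta> / 4\<close> on all of \<open>H\<close>
    into closeness at any smaller scale (\<open>restricted_gluing\<close>, \<open>restricted_dense_homoclinic\<close>).
    Thus \<open>(H, XH)\<close> with \<open>f\<close> is again a system in \<open>class_C4\<close>, with base group \<open>H\<close>.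

  \<^item> If \<open>f ^^ n\<close> vanishes on \<open>XH\<close>, it vanishes on \<open>X\<close>: any \<open>x\<close> agrees on \<open>H\<close>, up to \<open>\<Delta> / 4\<close>, with
    some point of \<open>XH\<close>, so \<open>(f ^^ n) x\<close> is within \<open>\<Delta> / 4\<close> of \<open>0\<close>; applying this to all translates
    of \<open>x\<close> and using expansivity gives \<open>(f ^^ n) x = 0\<close> (\<open>nilpotent_from_restriction\<close>).

  Having a single tier, \<open>(H, XH)\<close> lies in \<open>class_C2\<close> and \<open>class_C4\<close> at once, and in \<open>class_C3\<close> if
  \<open>H\<close> is residually finite. So it serves for all three hypotheses, once it is carried over to the
  types for which nil-rigidity of \<open>H\<close> is assumed (\<open>relabelled_evolution\<close>).
\<close>

section \<open>Expansive systems on compact metric spaces\<close>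

text \<open>
  A point of a compact metric space is determined by its distances to a countable dense set, so the
  space has at most the cardinality of the continuum and can be relabelled by real sequences.
\<close>
lemma (in Metric_space) compact_space_embeds_in_sequences:
  assumes "compact_space mtopology"
  shows "\<exists>\<phi> :: 'a \<Rightarrow> nat \<Rightarrow> real. inj_on \<phi> M"
proof (cases "M = {}")
  case False
  have tb: "mtotally_bounded M"
    using assms compact_space_eq_mcomplete_mtotally_bounded by blast
  have "\<exists>K. finite K \<and> K \<subseteq> M \<and> M \<subseteq> (\<Union>x\<in>K. mball x (inverse (real (Suc n))))" for n
    using tb by (simp add: mtotally_bounded_def)
  then obtain K where K: "\<And>n. finite (K n)" "\<And>n. K n \<subseteq> M"
      "\<And>n. M \<subseteq> (\<Union>x\<in>K n. mball x (inverse (real (Suc n))))"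
    by metis
  define Q where "Q = (\<Union>n. K n)"
  have Q: "countable Q" "Q \<subseteq> M"
    unfolding Q_def using K by (auto intro: countable_finite)
  have "Q \<noteq> {}"
    unfolding Q_def using K(3)[of 0] False by auto
  with Q have range: "range (from_nat_into Q) = Q"
    by (simp add: range_from_nat_into)
  have "inj_on (\<lambda>x n. d x (from_nat_into Q n)) M"
  proof (rule inj_onI)
    fix x y assume xy: "x \<in> M" "y \<in> M"
      and eq: "(\<lambda>n. d x (from_nat_into Q n)) = (\<lambda>n. d y (from_nat_into Q n))"
    have eqQ: "d x q = d y q" if "q \<in> Q" for q
      using fun_cong[OF eq] that range by (metis imageE)
    have "d x y \<le> 2 * inverse (real (Suc n))" for n
    proof -
      obtain q where q: "q \<in> K n" "d q x < inverse (real (Suc n))"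
        using K(3)[of n] xy(1) by auto
      then have "q \<in> Q" "q \<in> M"
        using K(2) by (auto simp: Q_def)
      then have "d x y \<le> d x q + d q y" "d x q = d y q"
        using triangle[of x q y] xy eqQ by (auto simp: commute)
      then show ?thesis
        using q(2) by (simp add: commute)
    qed
    moreover have "(\<lambda>n. 2 * inverse (real (Suc n))) \<longlonglongrightarrow> 0"
      using tendsto_mult_right_zero[OF LIMSEQ_inverse_real_of_nat] by simp
    ultimately have "d x y \<le> 0"
      by (meson LIMSEQ_le_const)
    then show "x = y"
      using xy by (metis nonneg order_antisym zero)
  qed
  then show ?thesis by blast
qed auto

lemma (in Metric_space) continuous_map_selfD:
  assumes "continuous_map mtopology mtopology u" "x \<in> M" "\<epsilon> > 0"
  obtains \<delta> where "\<delta> > 0" "\<And>y. \<lbrakk>y \<in> M; d x y < \<delta>\<rbrakk> \<Longrightarrow> d (u x) (u y) < \<epsilon>"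
  using assms metric_continuous_map[OF Metric_space_axioms, of u] by meson

definition expansivity_constant ::
  "'x set \<Rightarrow> ('x \<Rightarrow> 'x \<Rightarrow> real) \<Rightarrow> 'h monoid \<Rightarrow> ('h \<Rightarrow> 'x \<Rightarrow> 'x) \<Rightarrow> real \<Rightarrow> bool" where
  "expansivity_constant X d G act \<Delta> \<longleftrightarrow>
     (\<forall>x\<in>X. \<forall>y\<in>X. (\<forall>g\<in>carrier G. d (act g x) (act g y) \<le> \<Delta>) \<longrightarrow> x = y)"

lemma expansive_iff_constant:
  "expansive X d G act \<longleftrightarrow> (\<exists>\<Delta>. 0 < \<Delta> \<and> \<Delta> \<le> 1 \<and> expansivity_constant X d G act \<Delta>)"
  by (simp add: expansive_def expansivity_constant_def)

text \<open>
  Unlike in \<open>pointed_system\<close>, where the maps \<open>act g\<close> are \<open>undefined\<close> off \<open>X\<close>, the conditions concern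
  the values on \<open>X\<close> only, so that the same function \<open>act\<close> serves for a subgroup and an invariant
  subset.
\<close>
locale expansive_system = Metric_space X d + group G
  for X :: "'x set" and d :: "'x \<Rightarrow> 'x \<Rightarrow> real" and z :: 'x
    and G :: "'h monoid" (structure) and act :: "'h \<Rightarrow> 'x \<Rightarrow> 'x" +
  assumes compact: "compact_space mtopology"
    and act_closed: "\<And>g x. \<lbrakk>g \<in> carrier G; x \<in> X\<rbrakk> \<Longrightarrow> act g x \<in> X"
    and act_one: "\<And>x. x \<in> X \<Longrightarrow> act \<one> x = x"
    and act_mult: "\<And>g h x. \<lbrakk>g \<in> carrier G; h \<in> carrier G; x \<in> X\<rbrakk> \<Longrightarrow>
      act (g \<otimes> h) x = act g (act h x)"
    and act_continuous: "\<And>g. g \<in> carrier G \<Longrightarrow> continuous_map mtopology mtopology (act g)"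
    and zero_in: "z \<in> X"
    and zero_fixed: "\<And>g. g \<in> carrier G \<Longrightarrow> act g z = z"
    and expansive: "expansive X d G act"
begin

text \<open>
  This generalizes the Curtis--Hedlund--Lyndon theorem: a continuous map depends, up to any
  prescribed error, on finitely many coordinates. The pairs whose images are at distance at least
  \<open>\<epsilon>\<close> form a compact set off the diagonal; by expansivity it is covered by the open sets of
  pairs that a given group element separates, and a finite subcover gives the coordinates.
\<close>
lemma expansive_local_rule:
  assumes \<Delta>: "expansivity_constant X d G act \<Delta>"
    and u: "continuous_map mtopology mtopology u" and "\<epsilon> > 0"
  shows "\<exists>K. finite K \<and> K \<subseteq> carrier G \<and>
    (\<forall>x\<in>X. \<forall>y\<in>X. (\<forall>k\<in>K. d (act k x) (act k y) \<le> \<Delta>) \<longrightarrow> d (u x) (u y) < \<epsilon>)"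
proof -
  let ?P = "prod_topology mtopology mtopology"
  have dist_cont: "continuous_map ?P euclideanreal (\<lambda>w. d (v (fst w)) (v (snd w)))"
    if "continuous_map mtopology mtopology v" for v
  proof -
    have "continuous_map ?P mtopology (\<lambda>w. v (fst w))" "continuous_map ?P mtopology (\<lambda>w. v (snd w))"
      using continuous_map_compose[OF continuous_map_fst that]
        continuous_map_compose[OF continuous_map_snd that] by (simp_all add: o_def)
    then show ?thesis
      using continuous_map_mdist[of ?P Self "\<lambda>w. v (fst w)" "\<lambda>w. v (snd w)"]
      by (simp add: mtopology_of_def)
  qed
  define C where "C = {w \<in> topspace ?P. d (u (fst w)) (u (snd w)) \<in> {\<epsilon>..}}"
  define U where "U g = {w \<in> topspace ?P. d (act g (fst w)) (act g (snd w)) \<in> {\<Delta><..}}" for g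
  have "closedin ?P C"
    unfolding C_def by (rule closedin_continuous_map_preimage[OF dist_cont[OF u]]) simp
  then have "compactin ?P C"
    using compact compact_space_prod_topology closedin_compact_space by blast
  moreover have "openin ?P (U g)" if "g \<in> carrier G" for g
    unfolding U_def
    by (rule openin_continuous_map_preimage[OF dist_cont[OF act_continuous[OF that]]]) simp
  moreover have "C \<subseteq> \<Union> (U ` carrier G)"
  proof
    fix w assume w: "w \<in> C"
    then have "fst w \<in> X" "snd w \<in> X" "\<epsilon> \<le> d (u (fst w)) (u (snd w))"
      by (auto simp: C_def)
    moreover from this have "fst w \<noteq> snd w"
      using \<open>\<epsilon> > 0\<close> u by (force simp: continuous_map_def)
    ultimately obtain g where "g \<in> carrier G" "\<Delta> < d (act g (fst w)) (act g (snd w))"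
      using \<Delta> unfolding expansivity_constant_def by (meson not_le)
    then show "w \<in> \<Union> (U ` carrier G)"
      using w by (auto simp: U_def C_def)
  qed
  ultimately have "\<exists>\<F>. finite \<F> \<and> \<F> \<subseteq> U ` carrier G \<and> C \<subseteq> \<Union>\<F>"
    by (auto simp: compactin_def)
  then obtain K where K: "finite K" "K \<subseteq> carrier G" "C \<subseteq> \<Union> (U ` K)"
    by (metis finite_subset_image)
  have "d (u x) (u y) < \<epsilon>" if "x \<in> X" "y \<in> X" "\<forall>k\<in>K. d (act k x) (act k y) \<le> \<Delta>" for x y
  proof (rule ccontr)
    assume "\<not> d (u x) (u y) < \<epsilon>"
    then have "(x, y) \<in> C"
      using that by (auto simp: C_def)
    then show False
      using K(3) that(3) by (fastforce simp: U_def)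
  qed
  then show ?thesis
    using K by blast
qed

text \<open>The case of the identity map.\<close>
lemma expansive_separation:
  assumes \<Delta>: "expansivity_constant X d G act \<Delta>"
    and "\<epsilon> > 0"
  shows "\<exists>K. finite K \<and> K \<subseteq> carrier G \<and>
    (\<forall>x\<in>X. \<forall>y\<in>X. (\<forall>k\<in>K. d (act k x) (act k y) \<le> \<Delta>) \<longrightarrow> d x y < \<epsilon>)"
proof -
  have "continuous_map mtopology mtopology (\<lambda>x. x)"
    by simp
  from expansive_local_rule[OF \<Delta> this \<open>\<epsilon> > 0\<close>] show ?thesis .
qed

lemma finitely_many_act_continuous:
  assumes "finite K" "K \<subseteq> carrier G" "x \<in> X" "\<epsilon> > 0"
  obtains \<eta> where "\<eta> > 0" "\<And>y k. \<lbrakk>y \<in> X; d x y < \<eta>; k \<in> K\<rbrakk> \<Longrightarrow> d (act k x) (act k y) < \<epsilon>"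
proof -
  have "\<exists>\<eta>>0. \<forall>y\<in>X. d x y < \<eta> \<longrightarrow> (\<forall>k\<in>K. d (act k x) (act k y) < \<epsilon>)"
    using assms(1,2)
  proof (induction K)
    case empty
    then show ?case by (intro exI[of _ 1]) auto
  next
    case (insert k K)
    then obtain \<eta> where "\<eta> > 0" "\<forall>y\<in>X. d x y < \<eta> \<longrightarrow> (\<forall>k\<in>K. d (act k x) (act k y) < \<epsilon>)"
      by auto
    moreover have "k \<in> carrier G"
      using insert by auto
    from act_continuous[OF this] obtain \<eta>' where
      "\<eta>' > 0" "\<And>y. y \<in> X \<Longrightarrow> d x y < \<eta>' \<Longrightarrow> d (act k x) (act k y) < \<epsilon>"
      using continuous_map_selfD[OF _ assms(3,4)] by blast
    ultimately show ?case
      by (intro exI[of _ "min \<eta> \<eta>'"]) auto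
  qed
  then show thesis
    using that by blast
qed

end

section \<open>Gluing and evolutions\<close>

text \<open>
  Gluing is stated for functions \<open>p\<close> from the group to \<open>X\<close>, where \<open>p g\<close> is the point to be followed
  at \<open>g\<close>, in place of families \<open>(A\<^sub>i, x\<^sub>i)\<close>. The two forms agree, because parts with the same
  point can be merged: the boundary of a union of parts is contained in the union of their
  boundaries. The functional form has no index set, and so it can be transferred between groups
  drawn from different types.
\<close>
locale gluing_evolution = expansive_system X d z G act
  for X :: "'x set" and d :: "'x \<Rightarrow> 'x \<Rightarrow> real" and z :: 'x
    and G :: "'h monoid" (structure) and act :: "'h \<Rightarrow> 'x \<Rightarrow> 'x" and f :: "'x \<Rightarrow> 'x" +
  assumes gluing: "\<And>\<epsilon>. \<epsilon> > 0 \<Longrightarrow> \<exists>\<delta>>0. \<exists>E. finite E \<and> E \<subseteq> carrier G \<and>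
      (\<forall>p. (\<forall>g\<in>carrier G. p g \<in> X) \<and>
         (\<forall>g\<in>carrier G. \<forall>e\<in>E. p (e \<otimes> g) \<noteq> p g \<longrightarrow> d (act g (p g)) z < \<delta>) \<longrightarrow>
         (\<exists>y\<in>X. \<forall>g\<in>carrier G. d (act g y) (act g (p g)) < \<epsilon>))"
    and dense_homoclinic: "\<And>x \<epsilon>. \<lbrakk>x \<in> X; \<epsilon> > 0\<rbrakk> \<Longrightarrow>
      \<exists>y\<in>X. homoclinic d z G act y \<and> d x y < \<epsilon>"
    and evolution_continuous: "continuous_map mtopology mtopology f"
    and equivariant: "\<And>g x. \<lbrakk>g \<in> carrier G; x \<in> X\<rbrakk> \<Longrightarrow> f (act g x) = act g (f x)"
    and tends_to_zero: "\<And>x \<epsilon>. \<lbrakk>x \<in> X; \<epsilon> > 0\<rbrakk> \<Longrightarrow> \<exists>N. \<forall>n\<ge>N. d ((f ^^ n) x) z < \<epsilon>"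
begin

lemma evolution_closed: "x \<in> X \<Longrightarrow> f x \<in> X"
  using evolution_continuous by (auto simp: continuous_map_def)

lemma iterate_closed: "x \<in> X \<Longrightarrow> (f ^^ n) x \<in> X"
  by (induction n) (auto simp: evolution_closed)

lemma iterate_equivariant:
  "\<lbrakk>g \<in> carrier G; x \<in> X\<rbrakk> \<Longrightarrow> (f ^^ n) (act g x) = act g ((f ^^ n) x)"
  by (induction n) (auto simp: equivariant iterate_closed)

text \<open>The orbit of \<open>z\<close> tends to \<open>z\<close>, and the limit of an orbit is fixed by continuity.\<close>
lemma evolution_zero: "f z = z"
proof (rule ccontr)
  assume "f z \<noteq> z"
  define \<epsilon> where "\<epsilon> = d (f z) z / 2"
  have fz: "f z \<in> X" and "\<epsilon> > 0"
    using \<open>f z \<noteq> z\<close> evolution_closed zero_in by (auto simp: \<epsilon>_def)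
  then obtain \<delta> where \<delta>: "\<delta> > 0" "\<And>x. x \<in> X \<Longrightarrow> d z x < \<delta> \<Longrightarrow> d (f z) (f x) < \<epsilon>"
    using continuous_map_selfD[OF evolution_continuous zero_in \<open>\<epsilon> > 0\<close>] by blast
  obtain N where N: "\<And>n. n \<ge> N \<Longrightarrow> d ((f ^^ n) z) z < min \<delta> \<epsilon>"
    using tends_to_zero[OF zero_in, of "min \<delta> \<epsilon>"] \<delta> \<open>\<epsilon> > 0\<close> by auto
  have "d (f z) (f ((f ^^ N) z)) < \<epsilon>"
    using \<delta>(2)[OF iterate_closed[OF zero_in]] N[of N] by (simp add: commute)
  moreover have "d ((f ^^ Suc N) z) z < \<epsilon>"
    using N[of "Suc N"] by simp
  moreover have "d (f z) z \<le> d (f z) ((f ^^ Suc N) z) + d ((f ^^ Suc N) z) z"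
    using triangle fz iterate_closed zero_in by blast
  ultimately show False
    by (simp add: \<epsilon>_def)
qed

end

section \<open>Restriction to a finitely generated subgroup\<close>

text \<open>
  The subgroup \<open>H\<close> contains the set \<open>E\<^sub>0\<close> that governs gluing at the scale \<open>\<Delta> / 4\<close>, and it is large
  enough for \<open>f x\<close> to be determined at this scale by the translates of \<open>x\<close> under \<open>H\<close>.
  At the scale \<open>\<Delta> / 4\<close> the chains of triangle inequalities below, which have at most three links,
  stay within \<open>\<Delta>\<close>.
\<close>
locale supporting_subgroup = gluing_evolution X d z G act f
  for X :: "'x set" and d :: "'x \<Rightarrow> 'x \<Rightarrow> real" and z :: 'x
    and G :: "'h monoid" (structure) and act :: "'h \<Rightarrow> 'x \<Rightarrow> 'x" and f :: "'x \<Rightarrow> 'x" +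
  fixes \<Delta> \<delta>\<^sub>0 :: real and E\<^sub>0 H :: "'h set"
  assumes \<Delta>: "0 < \<Delta>" "\<Delta> \<le> 1" "expansivity_constant X d G act \<Delta>"
    and H: "subgroup H G"
    and E\<^sub>0: "finite E\<^sub>0" "E\<^sub>0 \<subseteq> H" and \<delta>\<^sub>0: "\<delta>\<^sub>0 > 0"
    and glue: "\<And>p. \<lbrakk>\<And>g. g \<in> carrier G \<Longrightarrow> p g \<in> X;
        \<And>g e. \<lbrakk>g \<in> carrier G; e \<in> E\<^sub>0; p (e \<otimes> g) \<noteq> p g\<rbrakk> \<Longrightarrow> d (act g (p g)) z < \<delta>\<^sub>0\<rbrakk> \<Longrightarrow>
        \<exists>y\<in>X. \<forall>g\<in>carrier G. d (act g y) (act g (p g)) < \<Delta> / 4"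
    and local_rule: "\<And>x y. \<lbrakk>x \<in> X; y \<in> X; \<And>h. h \<in> H \<Longrightarrow> d (act h x) (act h y) \<le> \<Delta>\<rbrakk> \<Longrightarrow>
        d (f x) (f y) < \<Delta> / 4"
begin

text \<open>The points supported on \<open>H\<close>, up to the scale \<open>\<Delta> / 4\<close>.\<close>
definition XH :: "'x set" where
  "XH = {x \<in> X. \<forall>g\<in>carrier G - H. d (act g x) z \<le> \<Delta> / 4}"

abbreviation GH :: "'h monoid" where "GH \<equiv> G\<lparr>carrier := H\<rparr>"

lemma H_carrier: "h \<in> H \<Longrightarrow> h \<in> carrier G"
  using H by (rule subgroup.mem_carrier)

lemma H_mult: "\<lbrakk>h \<in> H; k \<in> H\<rbrakk> \<Longrightarrow> h \<otimes> k \<in> H"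
  using H by (rule subgroup.m_closed)

lemma coset_complement:
  assumes "h \<in> H" "g \<in> carrier G - H"
  shows "h \<otimes> g \<in> carrier G - H" "g \<otimes> h \<in> carrier G - H"
  using assms H H_carrier subgroup.mem_carrier[OF H]
  by (auto simp: subgroup.m_closed)
     (metis H_carrier inv_solve_left inv_solve_right subgroup.m_closed subgroup.m_inv_closed)+

lemma XH_subset: "x \<in> XH \<Longrightarrow> x \<in> X"
  by (simp add: XH_def)

lemma XH_outside: "\<lbrakk>x \<in> XH; g \<in> carrier G; g \<notin> H\<rbrakk> \<Longrightarrow> d (act g x) z \<le> \<Delta> / 4"
  by (simp add: XH_def)

lemma zero_in_XH: "z \<in> XH"
  using zero_in zero_fixed \<Delta> by (simp add: XH_def)

lemma act_XH: "\<lbrakk>h \<in> H; x \<in> XH\<rbrakk> \<Longrightarrow> act h x \<in> XH"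
  using coset_complement(2) H_carrier act_closed by (auto simp: XH_def simp flip: act_mult)

text \<open>
  For \<open>g\<close> outside \<open>H\<close> the whole coset \<open>H g\<close> lies outside \<open>H\<close>. There a point of \<open>XH\<close> is close
  to \<open>0\<close>, so the local rule compares \<open>f x\<close> at \<open>g\<close> with \<open>f 0 = 0\<close>.
\<close>
lemma evolution_XH:
  assumes x: "x \<in> XH"
  shows "f x \<in> XH"
proof -
  have "d (act g (f x)) z \<le> \<Delta> / 4" if g: "g \<in> carrier G - H" for g
  proof -
    have "d (f (act g x)) (f z) < \<Delta> / 4"
    proof (rule local_rule)
      fix h assume h: "h \<in> H"
      then have "d (act h (act g x)) z \<le> \<Delta> / 4"
        using XH_outside[OF x, of "h \<otimes> g"] coset_complement(1)[OF h g] g XH_subset[OF x] H_carrier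
        by (simp add: act_mult)
      then show "d (act h (act g x)) (act h z) \<le> \<Delta>"
        using \<Delta>(1) zero_fixed H_carrier[OF h] by simp
    qed (use g XH_subset[OF x] act_closed zero_in in auto)
    then show ?thesis
      using g XH_subset[OF x] by (simp add: equivariant evolution_zero)
  qed
  then show ?thesis
    using evolution_closed[OF XH_subset[OF x]] by (simp add: XH_def)
qed

lemma XH_topology: "Metric_space.mtopology XH d = subtopology mtopology XH"
proof -
  interpret Submetric X d XH
    by unfold_locales (auto simp: XH_def)
  show ?thesis
    by (rule mtopology_submetric)
qed

lemma continuous_on_XH:
  assumes "continuous_map mtopology mtopology u" "u ` XH \<subseteq> XH"
  shows "continuous_map (Metric_space.mtopology XH d) (Metric_space.mtopology XH d) u"
  unfolding XH_topology using assms
  by (auto simp: continuous_map_in_subtopology continuous_map_from_subtopology)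

lemma XH_compact: "compact_space (Metric_space.mtopology XH d)"
proof -
  have "closedin mtopology {x \<in> topspace mtopology. act g x \<in> mcball z (\<Delta> / 4)}"
    if "g \<in> carrier G" for g
    by (rule closedin_continuous_map_preimage[OF act_continuous[OF that] closedin_mcball])
  moreover have "{x \<in> topspace mtopology. act g x \<in> mcball z (\<Delta> / 4)} =
      {x \<in> X. d (act g x) z \<le> \<Delta> / 4}" if "g \<in> carrier G" for g
    using that act_closed zero_in commute by auto
  ultimately have "closedin mtopology {x \<in> X. d (act g x) z \<le> \<Delta> / 4}" if "g \<in> carrier G" for g
    using that by simp
  moreover have "closedin mtopology X"
    using closedin_topspace[of mtopology] by simp
  ultimately have "closedin mtopology (\<Inter> (insert X ((\<lambda>g. {x \<in> X. d (act g x) z \<le> \<Delta> / 4}) ` (carrier G - H))))"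
    by (intro closedin_Inter) auto
  moreover have "\<Inter> (insert X ((\<lambda>g. {x \<in> X. d (act g x) z \<le> \<Delta> / 4}) ` (carrier G - H))) = XH"
    by (auto simp: XH_def)
  ultimately show ?thesis
    unfolding XH_topology using compact closedin_compact_space compact_space_subtopology by metis
qed

text \<open>Outside \<open>H\<close> two points of \<open>XH\<close> differ by at most \<open>\<Delta> / 2\<close>, so \<open>H\<close> must separate them.\<close>
lemma expansive_on_XH: "expansivity_constant XH d GH act \<Delta>"
  unfolding expansivity_constant_def
proof (intro ballI impI)
  fix x y assume "x \<in> XH" "y \<in> XH" "\<forall>h\<in>carrier GH. d (act h x) (act h y) \<le> \<Delta>"
  then have assms: "x \<in> XH" "y \<in> XH" "\<forall>h\<in>H. d (act h x) (act h y) \<le> \<Delta>"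
    by simp_all
  have "\<forall>g\<in>carrier G. d (act g x) (act g y) \<le> \<Delta>"
  proof
    fix g assume g: "g \<in> carrier G"
    show "d (act g x) (act g y) \<le> \<Delta>"
    proof (cases "g \<in> H")
      case False
      have "d (act g x) (act g y) \<le> d (act g x) z + d (act g y) z"
        using triangle' act_closed[OF g] assms XH_subset zero_in by blast
      with False g assms XH_outside[of x g] XH_outside[of y g] \<Delta>(1) show ?thesis
        by simp
    qed (use assms in auto)
  qed
  then show "x = y"
    using \<Delta>(3) assms XH_subset unfolding expansivity_constant_def by blast
qed

sublocale restricted: expansive_system XH d z GH act
proof -
  interpret XM: Metric_space XH d
    by (rule subspace) (auto simp: XH_def)
  interpret HG: group GH
    by (rule subgroup_imp_group[OF H])
  show "expansive_system XH d z GH act"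
  proof
    show "compact_space XM.mtopology"
      by (rule XH_compact)
    show "continuous_map XM.mtopology XM.mtopology (act g)" if "g \<in> carrier GH" for g
      using that act_XH by (intro continuous_on_XH act_continuous) (auto simp: H_carrier)
    show "expansive XH d GH act"
      unfolding expansive_iff_constant using \<Delta>(1,2) expansive_on_XH by blast
  qed (auto simp: act_XH H_carrier XH_subset act_one act_mult zero_in_XH zero_fixed)
qed

text \<open>
  Extending the assignment by \<open>0\<close> outside \<open>H\<close> creates no new boundary: \<open>E\<^sub>0\<close> maps \<open>H\<close> into \<open>H\<close>
  and the complement of \<open>H\<close> into itself.
\<close>
lemma glue_inside:
  assumes p: "\<And>h. h \<in> H \<Longrightarrow> p h \<in> X"
    and small: "\<And>h e. \<lbrakk>h \<in> H; e \<in> E\<^sub>0; p (e \<otimes> h) \<noteq> p h\<rbrakk> \<Longrightarrow> d (act h (p h)) z < \<delta>\<^sub>0"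
  obtains y where "y \<in> XH" "\<And>h. h \<in> H \<Longrightarrow> d (act h y) (act h (p h)) < \<Delta> / 4"
proof -
  define q where "q g = (if g \<in> H then p g else z)" for g
  have "\<exists>y\<in>X. \<forall>g\<in>carrier G. d (act g y) (act g (q g)) < \<Delta> / 4"
  proof (rule glue)
    show "q g \<in> X" if "g \<in> carrier G" for g
      using p zero_in by (simp add: q_def)
    fix g e assume g: "g \<in> carrier G" and e: "e \<in> E\<^sub>0" and ne: "q (e \<otimes> g) \<noteq> q g"
    have "e \<in> H"
      using e E\<^sub>0 by blast
    show "d (act g (q g)) z < \<delta>\<^sub>0"
    proof (cases "g \<in> H")
      case True
      then show ?thesis
        using ne H_mult[OF \<open>e \<in> H\<close>] small[OF _ e] by (simp add: q_def)
    next
      case False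
      then show ?thesis
        using ne coset_complement(1)[OF \<open>e \<in> H\<close>, of g] g by (simp add: q_def)
    qed
  qed
  then obtain y where y: "y \<in> X" "\<And>g. g \<in> carrier G \<Longrightarrow> d (act g y) (act g (q g)) < \<Delta> / 4"
    by blast
  have "y \<in> XH"
    using y by (force simp: XH_def q_def zero_fixed)
  moreover have "d (act h y) (act h (p h)) < \<Delta> / 4" if "h \<in> H" for h
    using y(2)[OF H_carrier[OF that]] that by (simp add: q_def)
  ultimately show thesis
    by (rule that)
qed

text \<open>
  Choose \<open>K\<close> so that points of \<open>XH\<close> which are \<open>\<Delta>\<close>-close under \<open>K\<close> are \<open>\<epsilon>\<close>-close. The point \<open>y\<close>
  obtained by gluing at the scale \<open>\<Delta> / 4\<close> follows \<open>p\<close> at \<open>k \<otimes> a\<close> for every \<open>k \<in> K\<close>. If \<open>p\<close> takes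
  the same value at \<open>a\<close> and \<open>k \<otimes> a\<close>, this is the desired closeness under \<open>k\<close>. Otherwise both \<open>a\<close>
  and \<open>k \<otimes> a\<close> are boundary points with respect to \<open>k\<close> and its inverse, and the points assigned to
  them are both close to \<open>0\<close> there, hence to each other.
\<close>
lemma restricted_gluing:
  assumes "\<epsilon> > 0"
  shows "\<exists>\<delta>>0. \<exists>E. finite E \<and> E \<subseteq> H \<and>
      (\<forall>p. (\<forall>g\<in>H. p g \<in> XH) \<and>
         (\<forall>g\<in>H. \<forall>e\<in>E. p (e \<otimes> g) \<noteq> p g \<longrightarrow> d (act g (p g)) z < \<delta>) \<longrightarrow>
         (\<exists>y\<in>XH. \<forall>g\<in>H. d (act g y) (act g (p g)) < \<epsilon>))"
proof -
  obtain K where K: "finite K" "K \<subseteq> H"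
    "\<And>x y. \<lbrakk>x \<in> XH; y \<in> XH; \<forall>k\<in>K. d (act k x) (act k y) \<le> \<Delta>\<rbrakk> \<Longrightarrow> d x y < \<epsilon>"
    using restricted.expansive_separation[OF expansive_on_XH \<open>\<epsilon> > 0\<close>] by auto
  obtain \<eta> where \<eta>: "\<eta> > 0"
    "\<And>x k. \<lbrakk>x \<in> X; d z x < \<eta>; k \<in> K\<rbrakk> \<Longrightarrow> d (act k z) (act k x) < \<Delta> / 4"
    using finitely_many_act_continuous[OF K(1) _ zero_in, of "\<Delta> / 4"] K(2) \<Delta>(1) H_carrier
    by (metis divide_pos_pos subsetD subsetI zero_less_numeral)
  define \<delta> where "\<delta> = min \<delta>\<^sub>0 (min \<eta> (\<Delta> / 4))"
  \<comment> \<open>the inverses make \<open>k \<otimes> a\<close> a boundary point whenever \<open>a\<close> is one because of \<open>k\<close>\<close>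
  define E where "E = E\<^sub>0 \<union> K \<union> m_inv G ` K"
  have "\<delta> > 0"
    using \<delta>\<^sub>0 \<eta> \<Delta> by (simp add: \<delta>_def)
  moreover have "finite E" "E \<subseteq> H"
    using E\<^sub>0 K H by (auto simp: E_def subgroup.m_inv_closed)
  moreover have "\<exists>y\<in>XH. \<forall>g\<in>H. d (act g y) (act g (p g)) < \<epsilon>"
    if p: "\<forall>g\<in>H. p g \<in> XH"
      and small: "\<forall>g\<in>H. \<forall>e\<in>E. p (e \<otimes> g) \<noteq> p g \<longrightarrow> d (act g (p g)) z < \<delta>" for p
  proof -
    have pX: "p h \<in> X" if "h \<in> H" for h
      using p that XH_subset by blast
    obtain y where y: "y \<in> XH" "\<And>h. h \<in> H \<Longrightarrow> d (act h y) (act h (p h)) < \<Delta> / 4"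
      using glue_inside[of p] pX small unfolding E_def \<delta>_def by (metis Un_iff min_less_iff_conj)
    have "d (act a y) (act a (p a)) < \<epsilon>" if a: "a \<in> H" for a
    proof (rule K(3))
      show "\<forall>k\<in>K. d (act k (act a y)) (act k (act a (p a))) \<le> \<Delta>"
      proof
        fix k assume k: "k \<in> K"
        then have kH: "k \<in> H" and ka: "k \<otimes> a \<in> H"
          using K(2) a H_mult by auto
        have ka_eq: "act (k \<otimes> a) x = act k (act a x)" if "x \<in> X" for x
          using that kH a H_carrier act_mult by simp
        have close: "d (act k (act a y)) (act (k \<otimes> a) (p (k \<otimes> a))) < \<Delta> / 4"
          using y(2)[OF ka] ka_eq XH_subset[OF y(1)] by simp
        show "d (act k (act a y)) (act k (act a (p a))) \<le> \<Delta>"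
        proof (cases "p (k \<otimes> a) = p a")
          case True
          then show ?thesis
            using close ka_eq[OF pX[OF a]] \<Delta>(1) by simp
        next
          case False
          have "d (act a (p a)) z < \<delta>"
            using small a k False by (auto simp: E_def)
          then have 1: "d z (act k (act a (p a))) < \<Delta> / 4"
            using \<eta>(2)[of "act a (p a)" k] k pX[OF a] a act_closed H_carrier zero_fixed kH
            by (simp add: \<delta>_def commute)
          have "inv k \<otimes> (k \<otimes> a) = a"
            using kH a H_carrier by (simp add: m_assoc[symmetric])
          then have "d (act (k \<otimes> a) (p (k \<otimes> a))) z < \<delta>"
            using small ka k False unfolding E_def by (metis UnI2 image_eqI)
          then have 2: "d (act (k \<otimes> a) (p (k \<otimes> a))) z < \<Delta> / 4"
            by (simp add: \<delta>_def)
          have X: "act k (act a y) \<in> X" "act (k \<otimes> a) (p (k \<otimes> a)) \<in> X" "act k (act a (p a)) \<in> X"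
            using kH a ka pX XH_subset[OF y(1)] H_carrier act_closed by auto
          have "d (act k (act a y)) (act k (act a (p a))) \<le>
              d (act k (act a y)) (act (k \<otimes> a) (p (k \<otimes> a)))
              + (d (act (k \<otimes> a) (p (k \<otimes> a))) z + d z (act k (act a (p a))))"
            using triangle[OF X] triangle[OF X(2) zero_in X(3)] by linarith
          then show ?thesis
            using close 1 2 \<Delta>(1) by linarith
        qed
      qed
    qed (use a p y act_XH in auto)
    with y(1) show ?thesis
      by blast
  qed
  ultimately show ?thesis
    by (intro exI[of _ \<delta>] conjI exI[of _ E]) blast+
qed

text \<open>
  Approximate \<open>x\<close> by a \<open>G\<close>-homoclinic point \<open>w\<close> and glue \<open>w\<close> on \<open>H\<close> with \<open>0\<close> outside. The result
  \<open>y\<close> follows \<open>w\<close>, and so also \<open>x\<close>, within \<open>\<Delta>\<close> along any given finite part of \<open>H\<close>, and it is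
  \<open>\<Delta>\<close>-close to \<open>0\<close> at all but finitely many elements of \<open>H\<close>. By expansivity of \<open>H\<close> on \<open>XH\<close>
  the first fact makes \<open>y\<close> close to \<open>x\<close>, and the second one makes \<open>y\<close> homoclinic.
\<close>
lemma restricted_dense_homoclinic:
  assumes x: "x \<in> XH" and "\<epsilon> > 0"
  shows "\<exists>y\<in>XH. homoclinic d z GH act y \<and> d x y < \<epsilon>"
proof -
  obtain K where K: "finite K" "K \<subseteq> H"
    "\<And>x y. \<lbrakk>x \<in> XH; y \<in> XH; \<forall>k\<in>K. d (act k x) (act k y) \<le> \<Delta>\<rbrakk> \<Longrightarrow> d x y < \<epsilon>"
    using restricted.expansive_separation[OF expansive_on_XH \<open>\<epsilon> > 0\<close>] by auto
  obtain \<eta> where \<eta>: "\<eta> > 0"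
    "\<And>w k. \<lbrakk>w \<in> X; d x w < \<eta>; k \<in> K\<rbrakk> \<Longrightarrow> d (act k x) (act k w) < \<Delta> / 4"
    using finitely_many_act_continuous[OF K(1) _ XH_subset[OF x], of "\<Delta> / 4"] K(2) \<Delta>(1) H_carrier
    by (metis divide_pos_pos subsetD subsetI zero_less_numeral)
  obtain w where w: "w \<in> X" "homoclinic d z G act w" "d x w < \<eta>"
    using dense_homoclinic[OF XH_subset[OF x] \<eta>(1)] by blast
  obtain y where y: "y \<in> XH" "\<And>h. h \<in> H \<Longrightarrow> d (act h y) (act h w) < \<Delta> / 4"
    using glue_inside[of "\<lambda>_. w"] w(1) by auto
  have "d x y < \<epsilon>"
  proof (rule K(3)[OF x y(1)], rule ballI)
    fix k assume k: "k \<in> K"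
    then have "d (act k x) (act k y) \<le> d (act k x) (act k w) + d (act k y) (act k w)"
      using K(2) x y(1) w(1) XH_subset H_carrier act_closed by (intro triangle') auto
    then show "d (act k x) (act k y) \<le> \<Delta>"
      using \<eta>(2)[OF w(1,3) k] y(2)[of k] k K(2) \<Delta>(1) by force
  qed
  moreover have "homoclinic d z GH act y"
    unfolding homoclinic_def
  proof (intro allI impI)
    fix \<theta> :: real assume "\<theta> > 0"
    then obtain L where L: "finite L" "L \<subseteq> H"
      "\<And>x y. \<lbrakk>x \<in> XH; y \<in> XH; \<forall>k\<in>L. d (act k x) (act k y) \<le> \<Delta>\<rbrakk> \<Longrightarrow> d x y < \<theta>"
      using restricted.expansive_separation[OF expansive_on_XH \<open>\<theta> > 0\<close>] by auto
    obtain D where D: "finite D" "\<And>g. \<lbrakk>g \<in> carrier G; g \<notin> D\<rbrakk> \<Longrightarrow> d (act g w) z < \<Delta> / 4"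
      using w(2) \<Delta>(1) unfolding homoclinic_def
      by (metis Diff_iff divide_pos_pos zero_less_numeral)
    \<comment> \<open>the \<open>h\<close> for which some \<open>k \<otimes> h\<close> with \<open>k \<in> L\<close> falls into the exceptional set \<open>D\<close> of \<open>w\<close>\<close>
    define D' where "D' = H \<inter> (\<lambda>(k, g). inv k \<otimes> g) ` (L \<times> D)"
    have "d (act h y) z < \<theta>" if h: "h \<in> H - D'" for h
    proof (rule L(3))
      show "\<forall>k\<in>L. d (act k (act h y)) (act k z) \<le> \<Delta>"
      proof
        fix k assume k: "k \<in> L"
        then have kH: "k \<in> H" and kh: "k \<otimes> h \<in> H"
          using L(2) h H_mult by auto
        have "inv k \<otimes> (k \<otimes> h) = h"
          using kH h H_carrier by (simp add: m_assoc[symmetric])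
        then have "k \<otimes> h \<notin> D"
          using h k unfolding D'_def by force
        then have "d (act (k \<otimes> h) w) z < \<Delta> / 4"
          using D(2) kh H_carrier by blast
        moreover have "d (act (k \<otimes> h) y) z \<le> d (act (k \<otimes> h) y) (act (k \<otimes> h) w) + d (act (k \<otimes> h) w) z"
          using kh y(1) w(1) XH_subset H_carrier act_closed zero_in by (intro triangle) auto
        ultimately have "d (act (k \<otimes> h) y) z \<le> \<Delta>"
          using y(2)[OF kh] \<Delta>(1) by linarith
        then show "d (act k (act h y)) (act k z) \<le> \<Delta>"
          using kH h H_carrier act_mult XH_subset[OF y(1)] zero_fixed by simp
      qed
    qed (use h y act_XH zero_in_XH in auto)
    moreover have "finite D'" "D' \<subseteq> H"
      using L(1) D(1) by (auto simp: D'_def)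
    ultimately show "\<exists>E. finite E \<and> E \<subseteq> carrier GH \<and> (\<forall>g\<in>carrier GH - E. d (act g y) z < \<theta>)"
      by auto
  qed
  ultimately show ?thesis
    using y(1) by blast
qed

lemma restricted_gluing_evolution: "gluing_evolution XH d z GH act f"
proof
  show "continuous_map restricted.mtopology restricted.mtopology f"
    using evolution_XH by (intro continuous_on_XH evolution_continuous) auto
qed (use restricted_gluing restricted_dense_homoclinic equivariant tends_to_zero XH_subset H_carrier
  in \<open>auto\<close>)

text \<open>Closeness on all of \<open>H\<close> is reproduced by the local rule, without loss, under iteration.\<close>
lemma iterate_local:
  assumes "x \<in> X" "y \<in> X" "\<And>h. h \<in> H \<Longrightarrow> d (act h x) (act h y) < \<Delta> / 4" "h \<in> H"
  shows "d (act h ((f ^^ n) x)) (act h ((f ^^ n) y)) < \<Delta> / 4"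
  using assms(4)
proof (induction n arbitrary: h)
  case (Suc n)
  have "d (f (act h ((f ^^ n) x))) (f (act h ((f ^^ n) y))) < \<Delta> / 4"
  proof (rule local_rule)
    fix k assume k: "k \<in> H"
    have "d (act (k \<otimes> h) ((f ^^ n) x)) (act (k \<otimes> h) ((f ^^ n) y)) < \<Delta> / 4"
      by (rule Suc.IH[OF H_mult[OF k Suc.prems]])
    then show "d (act k (act h ((f ^^ n) x))) (act k (act h ((f ^^ n) y))) \<le> \<Delta>"
      using k Suc.prems H_carrier assms iterate_closed \<Delta>(1) by (simp add: act_mult)
  qed (use Suc.prems H_carrier assms iterate_closed act_closed in auto)
  then show ?case
    using Suc.prems H_carrier assms iterate_closed equivariant by simp
qed (use assms in auto)

text \<open>
  The restriction of a point to \<open>H\<close> is seen, up to the scale \<open>\<Delta> / 4\<close>, by a point of \<open>XH\<close>. It controls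
  only the value of \<open>f ^^ n\<close> near the unit, but the translates of the point control it elsewhere.
\<close>
lemma nilpotent_from_restriction:
  assumes nil: "\<And>x. x \<in> XH \<Longrightarrow> (f ^^ n) x = z" and x: "x \<in> X"
  shows "(f ^^ n) x = z"
proof -
  have small: "d ((f ^^ n) w) z < \<Delta> / 4" if w: "w \<in> X" for w
  proof -
    obtain y where y: "y \<in> XH" "\<And>h. h \<in> H \<Longrightarrow> d (act h y) (act h w) < \<Delta> / 4"
      using glue_inside[of "\<lambda>_. w"] w by auto
    have "d (act \<one> ((f ^^ n) y)) (act \<one> ((f ^^ n) w)) < \<Delta> / 4"
      by (rule iterate_local) (use y w XH_subset H subgroup.one_closed in auto)
    then show ?thesis
      using nil[OF y(1)] w zero_in iterate_closed by (simp add: act_one commute)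
  qed
  have "\<forall>g\<in>carrier G. d (act g ((f ^^ n) x)) (act g z) \<le> \<Delta>"
  proof
    fix g assume g: "g \<in> carrier G"
    show "d (act g ((f ^^ n) x)) (act g z) \<le> \<Delta>"
      using small[OF act_closed[OF g x]] \<Delta>(1) by (simp add: iterate_equivariant g x zero_fixed)
  qed
  then show ?thesis
    using \<Delta>(3) x iterate_closed zero_in unfolding expansivity_constant_def by blast
qed

end

context gluing_evolution
begin

text \<open>
  The two finite sets that must lie in \<open>H\<close> are chosen independently of \<open>n\<close>, so that one
  finitely generated subgroup controls all iterates of \<open>f\<close>.
\<close>
lemma finitely_generated_restriction:
  "\<exists>H XH. fg_subgroup H G \<and> gluing_evolution XH d z (G\<lparr>carrier := H\<rparr>) act f \<and>
     (\<forall>n. (\<forall>y\<in>XH. (f ^^ n) y = z) \<longrightarrow> (\<forall>x\<in>X. (f ^^ n) x = z))"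
proof -
  obtain \<Delta> where \<Delta>: "0 < \<Delta>" "\<Delta> \<le> 1" "expansivity_constant X d G act \<Delta>"
    using expansive unfolding expansive_iff_constant by (elim exE conjE) (rule that)
  have pos: "\<Delta> / 4 > 0"
    using \<Delta> by simp
  obtain \<delta>\<^sub>0 E\<^sub>0 where E\<^sub>0: "\<delta>\<^sub>0 > 0" "finite E\<^sub>0" "E\<^sub>0 \<subseteq> carrier G"
    "\<forall>p. (\<forall>g\<in>carrier G. p g \<in> X) \<and>
        (\<forall>g\<in>carrier G. \<forall>e\<in>E\<^sub>0. p (e \<otimes> g) \<noteq> p g \<longrightarrow> d (act g (p g)) z < \<delta>\<^sub>0) \<longrightarrow>
        (\<exists>y\<in>X. \<forall>g\<in>carrier G. d (act g y) (act g (p g)) < \<Delta> / 4)"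
    using gluing[OF pos] by (elim exE conjE) (rule that)
  obtain F where F: "finite F" "F \<subseteq> carrier G"
    "\<forall>x\<in>X. \<forall>y\<in>X. (\<forall>k\<in>F. d (act k x) (act k y) \<le> \<Delta>) \<longrightarrow> d (f x) (f y) < \<Delta> / 4"
    using expansive_local_rule[OF \<Delta>(3) evolution_continuous pos] by (elim exE conjE) (rule that)
  define H where "H = generate G (E\<^sub>0 \<union> F)"
  have sub: "E\<^sub>0 \<union> F \<subseteq> H"
    unfolding H_def by (auto intro: generate.incl)
  have fg: "fg_subgroup H G"
    unfolding fg_subgroup_def H_def using E\<^sub>0(2,3) F(1,2) by (intro exI[of _ "E\<^sub>0 \<union> F"]) simp
  interpret supporting_subgroup X d z G act f \<Delta> \<delta>\<^sub>0 E\<^sub>0 H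
  proof (intro supporting_subgroup.intro supporting_subgroup_axioms.intro gluing_evolution_axioms)
    show "subgroup H G"
      unfolding H_def using E\<^sub>0 F by (intro generate_is_subgroup) auto
    show "\<exists>y\<in>X. \<forall>g\<in>carrier G. d (act g y) (act g (p g)) < \<Delta> / 4"
      if "\<And>g. g \<in> carrier G \<Longrightarrow> p g \<in> X"
        "\<And>g e. \<lbrakk>g \<in> carrier G; e \<in> E\<^sub>0; p (e \<otimes> g) \<noteq> p g\<rbrakk> \<Longrightarrow> d (act g (p g)) z < \<delta>\<^sub>0" for p
      using E\<^sub>0(4)[rule_format, of p] that by simp
    show "d (f x) (f y) < \<Delta> / 4"
      if "x \<in> X" "y \<in> X" "\<And>h. h \<in> H \<Longrightarrow> d (act h x) (act h y) \<le> \<Delta>" for x y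
      using F(3)[rule_format, of x y] sub that by auto
  qed (use \<Delta> E\<^sub>0(1,2) sub in simp_all)
  show ?thesis
    using fg restricted_gluing_evolution nilpotent_from_restriction
    by (intro exI[of _ H] exI[of _ XH]) simp
qed

end

section \<open>Relabelling a system by standard types\<close>

lemma homoclinicE:
  assumes "homoclinic d z G act x" "\<epsilon> > 0"
  obtains E where "finite E" "E \<subseteq> carrier G" "\<forall>g\<in>carrier G - E. d (act g x) z < \<epsilon>"
  using assms(1)[unfolded homoclinic_def, rule_format, OF assms(2)] by (elim exE conjE) (rule that)

lemma group_actionI:
  assumes "group G"
    and ext: "\<And>g. g \<in> carrier G \<Longrightarrow> a g \<in> extensional E"
    and closed: "\<And>g x. \<lbrakk>g \<in> carrier G; x \<in> E\<rbrakk> \<Longrightarrow> a g x \<in> E"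
    and one: "\<And>x. x \<in> E \<Longrightarrow> a \<one>\<^bsub>G\<^esub> x = x"
    and mult: "\<And>g h x. \<lbrakk>g \<in> carrier G; h \<in> carrier G; x \<in> E\<rbrakk> \<Longrightarrow>
      a (g \<otimes>\<^bsub>G\<^esub> h) x = a g (a h x)"
  shows "group_action G E a"
proof -
  interpret group G by fact
  have inverse: "a (inv\<^bsub>G\<^esub> g) (a g x) = x" "a g (a (inv\<^bsub>G\<^esub> g) x) = x"
    if "g \<in> carrier G" "x \<in> E" for g x
    using that one mult by (simp_all flip: mult)
  have Bij: "a g \<in> Bij E" if "g \<in> carrier G" for g
  proof -
    have "bij_betw (a g) E E"
      using that inverse closed by (intro bij_betw_byWitness[of _ "a (inv\<^bsub>G\<^esub> g)"]) auto
    then show ?thesis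
      using ext[OF that] by (simp add: Bij_def)
  qed
  have "a (g \<otimes>\<^bsub>G\<^esub> h) = compose E (a g) (a h)" if "g \<in> carrier G" "h \<in> carrier G" for g h
    using that ext mult by (intro extensionalityI[of _ E]) (auto simp: compose_eq)
  with Bij have "a \<in> hom G (BijGroup E)"
    by (auto simp: hom_def BijGroup_def)
  then show ?thesis
    unfolding group_action_def group_hom_def group_hom_axioms_def
    using group_BijGroup is_group by blast
qed

text \<open>
  Nil-rigidity is assumed for systems with points in \<open>nat \<Rightarrow> real\<close>, group elements in \<open>'h \<times> nat\<close>
  and tiers in \<open>nat\<close>. A given system is therefore carried over along an injection \<open>\<phi>\<close> of its points,
  with the metric transported along it. The group is replaced by its product with a trivial group,
  and the only tier is \<open>0\<close>.
\<close>
locale relabelled_evolution = gluing_evolution X d z G act f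
  for X :: "'x set" and d :: "'x \<Rightarrow> 'x \<Rightarrow> real" and z :: 'x
    and G :: "'h monoid" (structure) and act :: "'h \<Rightarrow> 'x \<Rightarrow> 'x" and f :: "'x \<Rightarrow> 'x" +
  fixes \<phi> :: "'x \<Rightarrow> 'y"
  assumes inj: "inj_on \<phi> X"
begin

abbreviation "r \<equiv> inv_into X \<phi>"
abbreviation "D \<equiv> \<phi> ` X"
abbreviation "dD \<equiv> \<lambda>a b. d (r a) (r b)"
abbreviation "GD \<equiv> G \<times>\<times> singleton_group (0::nat)"
abbreviation "actD \<equiv> \<lambda>g. \<lambda>a\<in>D. \<phi> (act (fst g) (r a))"
abbreviation "fD \<equiv> \<lambda>a. \<phi> (f (r a))"

definition system :: "('y, nat, 'h \<times> nat) tds" where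
  "system = \<lparr>ambient = D, tdist = dD, tzero = \<phi> z, tiers = {0}, tle = {(0, 0)}, tbase = 0,
     tgroup = (\<lambda>_. GD), tspace = (\<lambda>_. D), tact = (\<lambda>_. actD), tmap = (\<lambda>_ _ g. g)\<rparr>"

lemma r_\<phi>: "x \<in> X \<Longrightarrow> r (\<phi> x) = x"
  using inj by (rule inv_into_f_f)

lemma \<phi>_eq_iff: "\<lbrakk>x \<in> X; y \<in> X\<rbrakk> \<Longrightarrow> \<phi> x = \<phi> y \<longleftrightarrow> x = y"
  using inj by (rule inj_on_eq_iff)

lemma carrier_GD: "carrier GD = carrier G \<times> {0}"
  by (simp add: DirProd_def)

lemma GD_simps:
  "(g, 0) \<otimes>\<^bsub>GD\<^esub> (h, 0) = (g \<otimes> h, 0)" "\<one>\<^bsub>GD\<^esub> = (\<one>, 0)"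
  by (simp_all add: DirProd_def singleton_group_def)

sublocale GD: group GD
  by (intro DirProd_group is_group) simp

sublocale DM: Metric_space D dD
proof
  show "dD a b = 0 \<longleftrightarrow> a = b" if "a \<in> D" "b \<in> D" for a b
    using that inj by (auto simp: r_\<phi>)
qed (auto simp: commute r_\<phi> triangle)

lemma \<phi>_continuous: "continuous_map mtopology DM.mtopology \<phi>"
  by (subst metric_continuous_map) (auto simp: DM.Metric_space_axioms r_\<phi>)

lemma r_continuous: "continuous_map DM.mtopology mtopology r"
  by (subst DM.metric_continuous_map) (auto simp: Metric_space_axioms r_\<phi>)

lemma conjugate_continuous:
  assumes "continuous_map mtopology mtopology u"
  shows "continuous_map DM.mtopology DM.mtopology (\<lambda>a. \<phi> (u (r a)))"
  using continuous_map_compose[OF continuous_map_compose[OF r_continuous assms] \<phi>_continuous]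
  by (simp add: o_def)

lemma D_compact: "compact_space DM.mtopology"
  using image_compactin[OF _ \<phi>_continuous, of X] compact by (simp add: compact_space_def)

lemma D_iterate: "x \<in> X \<Longrightarrow> (fD ^^ n) (\<phi> x) = \<phi> ((f ^^ n) x)"
  by (induction n) (auto simp: r_\<phi> iterate_closed)

lemma D_expansive: "expansive D dD GD actD"
proof -
  obtain \<Delta> where \<Delta>: "0 < \<Delta>" "\<Delta> \<le> 1" "expansivity_constant X d G act \<Delta>"
    using expansive unfolding expansive_iff_constant by (elim exE conjE) (rule that)
  have "expansivity_constant D dD GD actD \<Delta>"
    using \<Delta>(3) unfolding expansivity_constant_def
    by (auto simp: carrier_GD r_\<phi> \<phi>_eq_iff act_closed)
  with \<Delta> show ?thesis
    unfolding expansive_iff_constant by blast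
qed

lemma D_pointed_system: "pointed_system D dD (\<phi> z) GD actD"
proof -
  have "group_action GD D actD"
    by (rule group_actionI)
      (auto simp: carrier_GD GD_simps r_\<phi> \<phi>_eq_iff act_closed act_one act_mult GD.is_group)
  moreover have "continuous_map DM.mtopology DM.mtopology (actD g)" if "g \<in> carrier GD" for g
    using that by (intro continuous_map_eq[OF conjugate_continuous[OF act_continuous[of "fst g"]]])
      (auto simp: carrier_GD)
  ultimately show ?thesis
    unfolding pointed_system_def pointed_system_axioms_def
    by (auto simp: DM.Metric_space_axioms D_compact carrier_GD r_\<phi> zero_in zero_fixed)
qed

lemma D_tiered_system: "tiered_system system"
  by (rule tiered_system.intro)
    (auto simp: system_def DM.Metric_space_axioms D_compact zero_in D_pointed_system D_expansive
      preorder_on_def refl_on_def trans_def hom_def intro: finite_subset[of _ "{_}"])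

lemma D_evolution: "evolution system fD"
  by (auto simp: evolution_def ambient_top_def system_def carrier_GD r_\<phi> act_closed
      equivariant evolution_closed conjugate_continuous evolution_continuous)

lemma D_stabilizing: "stabilizing system fD"
  by (auto simp: stabilizing_def system_def D_iterate iterate_closed)

lemma D_dense: "weakly_dense_homoclinic system"
proof -
  have "homoclinic dD (\<phi> z) GD actD (\<phi> y)" if y: "y \<in> X" "homoclinic d z G act y" for y
    unfolding homoclinic_def
  proof (intro allI impI)
    fix \<epsilon> :: real assume "\<epsilon> > 0"
    then obtain E where "finite E" "E \<subseteq> carrier G" "\<forall>g\<in>carrier G - E. d (act g y) z < \<epsilon>"
      using homoclinicE[OF y(2)] by blast
    then show "\<exists>E. finite E \<and> E \<subseteq> carrier GD \<and> (\<forall>g\<in>carrier GD - E. dD (actD g (\<phi> y)) (\<phi> z) < \<epsilon>)"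
      using y(1) by (intro exI[of _ "E \<times> {0}"]) (auto simp: carrier_GD r_\<phi> act_closed zero_in)
  qed
  then show ?thesis
    using dense_homoclinic
    by (fastforce simp: weakly_dense_homoclinic_def system_def r_\<phi>)
qed

text \<open>
  A designation is turned into the assignment that sends \<open>g\<close> to the point of the part containing it.
\<close>
lemma D_gluing: "weakly_gluing system"
proof -
  have "\<exists>\<delta>>0. \<exists>E. finite E \<and> E \<subseteq> carrier GD \<and>
      (\<forall>(I :: ('h \<times> nat) set) A x. small_designation D dD (\<phi> z) GD actD \<delta> E I A x \<and>
         (\<forall>i\<in>I. x i \<in> D) \<longrightarrow> (\<exists>y. realization D dD actD \<epsilon> I A x y))"
    if "\<epsilon> > 0" for \<epsilon>
  proof -
    obtain \<delta> E where E: "\<delta> > 0" "finite E" "E \<subseteq> carrier G"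
      "\<forall>p. (\<forall>g\<in>carrier G. p g \<in> X) \<and>
         (\<forall>g\<in>carrier G. \<forall>e\<in>E. p (e \<otimes> g) \<noteq> p g \<longrightarrow> d (act g (p g)) z < \<delta>) \<longrightarrow>
         (\<exists>y\<in>X. \<forall>g\<in>carrier G. d (act g y) (act g (p g)) < \<epsilon>)"
      using gluing[OF \<open>\<epsilon> > 0\<close>] by (elim exE conjE) (rule that)
    have "\<exists>y. realization D dD actD \<epsilon> I A x y"
      if small: "small_designation D dD (\<phi> z) GD actD \<delta> (E \<times> {0}) I A x"
      for I :: "('h \<times> nat) set" and A x
    proof -
      have x: "x i \<in> D" if "i \<in> I" for i
        using small that by (simp add: small_designation_def designation_def)
      have disj: "i = j" if "i \<in> I" "j \<in> I" "g \<in> A i" "g \<in> A j" for i j g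
        using small that by (auto simp: small_designation_def designation_def disjoint_family_on_def)
      have cover: "\<Union> (A ` I) = carrier G \<times> {0}"
        using small by (simp add: small_designation_def designation_def carrier_GD)
      have boundary: "dD (actD g (x i)) (\<phi> z) < \<delta>"
        if "i \<in> I" "g \<in> group_boundary GD (E \<times> {0}) (A i)" for i g
        using small that by (simp add: small_designation_def)
      define part where "part g = (THE i. i \<in> I \<and> (g, 0) \<in> A i)" for g
      have part_eq: "part g = i" if "i \<in> I" "(g, 0) \<in> A i" for g i
        unfolding part_def using that disj by blast
      have part: "part g \<in> I" "(g, 0) \<in> A (part g)" if "g \<in> carrier G" for g
        using cover that part_eq by (metis SigmaI UN_E insertI1)+
      define p where "p g = r (x (part g))" for g
      have pX: "p g \<in> X" if "g \<in> carrier G" for g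
        using x[OF part(1)[OF that]] by (auto simp: p_def r_\<phi>)
      have "d (act g (p g)) z < \<delta>" if g: "g \<in> carrier G" and e: "e \<in> E" and ne: "p (e \<otimes> g) \<noteq> p g" for g e
      proof -
        have "(e \<otimes> g, 0) \<notin> A (part g)"
          using ne part_eq[OF part(1)[OF g]] by (auto simp: p_def)
        then have "(g, 0) \<in> group_boundary GD (E \<times> {0}) (A (part g))"
          using part(2)[OF g] e GD_simps(1)[of e g] unfolding group_boundary_def by force
        then show ?thesis
          using boundary[OF part(1)[OF g], of "(g, 0)"] x[OF part(1)[OF g]] g
          by (auto simp: r_\<phi> act_closed zero_in p_def)
      qed
      then obtain y where y: "y \<in> X" "\<And>g. g \<in> carrier G \<Longrightarrow> d (act g y) (act g (p g)) < \<epsilon>"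
        using E(4)[rule_format, of p] pX by blast
      have "dD (actD g (\<phi> y)) (actD g (x i)) < \<epsilon>" if i: "i \<in> I" and g: "g \<in> A i" for g i
      proof -
        obtain g' where g': "g = (g', 0)" "g' \<in> carrier G"
          using cover i g by blast
        then have "part g' = i"
          using part_eq i g by blast
        then show ?thesis
          using y(2)[OF g'(2)] x[OF i] y(1) g' by (auto simp: p_def r_\<phi> act_closed)
      qed
      then show ?thesis
        using y(1) unfolding realization_def by blast
    qed
    moreover have "finite (E \<times> {0::nat})" "E \<times> {0} \<subseteq> carrier GD"
      using E by (auto simp: carrier_GD)
    ultimately show ?thesis
      using E(1) by (intro exI[of _ \<delta>] conjI exI[of _ "E \<times> {0}"]) blast+
  qed
  then show ?thesis
    by (simp add: weakly_gluing_def system_def)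
qed

lemma D_asymptotically_nilpotent: "asymptotically_nilpotent system fD"
  unfolding asymptotically_nilpotent_def ambient_top_def
  using tends_to_zero
  by (auto simp: system_def DM.limit_metric_sequentially zero_in D_iterate iterate_closed r_\<phi>)

lemma system_in_C2: "(system, fD) \<in> class_C2"
  by (simp add: class_C2_def D_tiered_system D_evolution D_stabilizing D_gluing D_dense)

lemma system_base: "tiers system = {tbase system}" "tgroup system t = GD"
  by (simp_all add: system_def)

lemma GD_iso: "GD \<cong> G"
  by (rule is_isoI[of fst])
    (auto simp: iso_def hom_def carrier_GD GD_simps bij_betw_def inj_on_def image_iff)

text \<open>The quotient of a product by a product is the product of the quotients.\<close>
lemma GD_residually_finite:
  assumes "residually_finite G"
  shows "residually_finite GD"
  unfolding residually_finite_def
proof (intro ballI impI)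
  fix g assume g: "g \<in> carrier GD" "g \<noteq> \<one>\<^bsub>GD\<^esub>"
  define h where "h = fst g"
  have gh: "g = (h, 0)" and "h \<in> carrier G"
    using g(1) by (auto simp: carrier_GD h_def)
  moreover from gh g(2) have "h \<noteq> \<one>"
    by (auto simp: singleton_group_def)
  ultimately obtain N where N: "normal N G" "finite (carrier (G Mod N))" "h \<notin> N"
    using assms unfolding residually_finite_def by blast
  interpret T: group "singleton_group (0::nat)"
    by simp
  have T: "normal {0} (singleton_group (0::nat))"
    using T.normal_self by simp
  have "(\<lambda>(A, B). A \<times> B) ` (carrier (G Mod N) \<times> carrier (singleton_group (0::nat) Mod {0}))
      = carrier (GD Mod (N \<times> {0}))"
    using FactGroup_DirProd_multiplication_iso_set[OF T.is_group N(1) T]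
    by (auto simp: iso_iff)
  moreover have "finite (carrier (singleton_group (0::nat) Mod {0}))"
    by (simp add: FactGroup_def RCOSETS_def)
  ultimately have "finite (carrier (GD Mod (N \<times> {0})))"
    using N(2) by (metis finite_cartesian_product finite_imageI)
  moreover have "normal (N \<times> {0}) GD"
    by (rule DirProd_normal[OF T.is_group N(1) T])
  ultimately show "\<exists>N. normal N GD \<and> finite (carrier (GD Mod N)) \<and> g \<notin> N"
    using gh N(3) by blast
qed

end

section \<open>Nilpotency from nil-rigidity\<close>

text \<open>
  The relabelled system lies in \<open>class_C2\<close> and in \<open>class_C4\<close>, and also in \<open>class_C3\<close> if \<open>G\<close> is
  residually finite; so any one of the three hypotheses applies to it.
\<close>
lemma (in gluing_evolution) nilpotent_if_nil_rigid:
  assumes "nil_rigid (class_C2 :: 'h std_etds set) G \<or>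
      nil_rigid (class_C4 :: 'h std_etds set) G \<or>
      (nil_rigid (class_C3 :: 'h std_etds set) G \<and> residually_finite G)"
  shows "\<exists>n. \<forall>x\<in>X. (f ^^ n) x = z"
proof -
  obtain \<phi> :: "'x \<Rightarrow> nat \<Rightarrow> real" where "inj_on \<phi> X"
    using compact_space_embeds_in_sequences[OF compact] by blast
  interpret relabelled_evolution X d z G act f \<phi>
    by unfold_locales fact
  have C4: "(system, fD) \<in> class_C4"
    using system_in_C2 system_base by (simp add: class_C4_def)
  have C3: "(system, fD) \<in> class_C3" if "residually_finite G"
    using system_in_C2 system_base GD_residually_finite[OF that] by (simp add: class_C3_def)
  have use: "nilpotent_on system fD (tspace system (tbase system))"
    if "nil_rigid C G" "(system, fD) \<in> C" for C
    using that D_asymptotically_nilpotent GD_iso system_base unfolding nil_rigid_def by fastforce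
  have "nilpotent_on system fD D"
    using assms use system_in_C2 C4 C3 by (auto simp: system_def)
  then obtain n where "\<forall>a\<in>D. (fD ^^ n) a = \<phi> z"
    by (auto simp: nilpotent_on_def system_def)
  then have "\<forall>x\<in>X. (f ^^ n) x = z"
    using D_iterate inj iterate_closed zero_in by (auto dest: inj_onD)
  then show ?thesis ..
qed

lemma (in gluing_evolution) nilpotent_if_locally_nil_rigid:
  assumes "locally_group (nil_rigid (class_C2 :: 'h std_etds set)) G \<or>
      locally_group (nil_rigid (class_C4 :: 'h std_etds set)) G \<or>
      (locally_group (nil_rigid (class_C3 :: 'h std_etds set)) G \<and>
       locally_group residually_finite G)"
  shows "\<exists>n. \<forall>x\<in>X. (f ^^ n) x = z"
proof -
  obtain H Y where H: "fg_subgroup H G"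
    and Y: "gluing_evolution Y d z (G\<lparr>carrier := H\<rparr>) act f"
    and lift: "\<forall>n. (\<forall>y\<in>Y. (f ^^ n) y = z) \<longrightarrow> (\<forall>x\<in>X. (f ^^ n) x = z)"
    using finitely_generated_restriction by (elim exE conjE) (rule that)
  have "\<exists>n. \<forall>y\<in>Y. (f ^^ n) y = z"
    using assms H
    by (intro gluing_evolution.nilpotent_if_nil_rigid[OF Y]) (auto simp: locally_group_def)
  then show ?thesis
    using lift by blast
qed

text \<open>
  An assignment \<open>q\<close> is turned into a designation whose parts are the level sets of \<open>q\<close>. A level
  set is indexed by a chosen element of itself, so that the index set consists of group elements.
\<close>
lemma realization_of_assignment:
  fixes G :: "'h monoid" (structure)
  assumes "group G" and glue: "\<And>(I :: 'h set) A x. small_designation X d z G act \<delta> E I A x \<Longrightarrow>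
      \<exists>y. realization X d act \<epsilon> I A x y"
    and E: "E \<subseteq> carrier G"
    and q: "\<And>g. g \<in> carrier G \<Longrightarrow> q g \<in> X"
    and small: "\<And>g e. \<lbrakk>g \<in> carrier G; e \<in> E; q (e \<otimes> g) \<noteq> q g\<rbrakk> \<Longrightarrow> d (act g (q g)) z < \<delta>"
  shows "\<exists>y\<in>X. \<forall>g\<in>carrier G. d (act g y) (act g (q g)) < \<epsilon>"
proof -
  interpret group G by fact
  define rep where "rep a = (SOME g. g \<in> carrier G \<and> q g = a)" for a
  have rep: "rep (q g) \<in> carrier G" "q (rep (q g)) = q g" if "g \<in> carrier G" for g
    using someI[of "\<lambda>h. h \<in> carrier G \<and> q h = q g" g] that by (auto simp: rep_def)
  define I where "I = rep ` q ` carrier G"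
  define A where "A i = {g \<in> carrier G. q g = q i}" for i
  have "designation X G I A q"
    unfolding designation_def disjoint_family_on_def
    using q rep by (auto simp: I_def A_def)
  moreover have "d (act g (q i)) z < \<delta>" if boundary: "g \<in> group_boundary G E (A i)" for i g
  proof -
    obtain e where e: "e \<in> E" "e \<otimes> g \<notin> A i" and g: "g \<in> A i"
      using boundary by (auto simp: group_boundary_def)
    then have "q (e \<otimes> g) \<noteq> q g"
      using E by (auto simp: A_def)
    then have "d (act g (q g)) z < \<delta>"
      using small[of g e] e(1) g by (simp add: A_def)
    with g show ?thesis
      by (simp add: A_def)
  qed
  ultimately obtain y where "realization X d act \<epsilon> I A q y"
    using glue unfolding small_designation_def by blast
  then show ?thesis
    using rep unfolding realization_def I_def A_def by fastforce
qed

text \<open>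
  The base group is only isomorphic to \<open>G\<close>, so \<open>G\<close> acts through an isomorphism. With a single tier,
  the tiers that witness stabilization, gluing and density of homoclinic points are all the base.
\<close>
lemma single_tier_gluing_evolution:
  fixes S :: "('x, 't, 'h) tds" and G :: "'g monoid"
  assumes C4: "(S, f) \<in> class_C4" and iso: "tgroup S (tbase S) \<cong> G" and "group G"
    and nil: "asymptotically_nilpotent S f"
  shows "\<exists>act. gluing_evolution (tspace S (tbase S)) (tdist S) (tzero S) G act f"
proof -
  let ?b = "tbase S"
  let ?X = "tspace S ?b" and ?d = "tdist S" and ?z = "tzero S" and ?T = "tgroup S ?b"
    and ?a = "tact S ?b"
  have S: "tiered_system S" "evolution S f" "stabilizing S f" "weakly_gluing S"
      "weakly_dense_homoclinic S" and single: "tiers S = {?b}"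
    using C4 by (auto simp: class_C4_def class_C2_def)
  interpret tiered_system S by fact
  have tle: "(?b, t) \<in> tle S \<longleftrightarrow> t = ?b" for t
    using tiers_preorder base_least[OF base_in] single by (auto simp: preorder_on_def)
  interpret P: pointed_system ?X ?d ?z ?T ?a
    by (rule tier_system[OF base_in])
  interpret G: group G by fact
  interpret T: group ?T
    using P.group_hom by (simp add: group_hom_def)
  interpret amb: Metric_space "ambient S" ?d
    by (rule ambient_metric)
  interpret Submetric "ambient S" ?d ?X
    by unfold_locales (rule tier_subset[OF base_in])
  obtain \<psi>' where "\<psi>' \<in> Group.iso ?T G"
    using iso unfolding is_iso_def by blast
  then obtain \<psi> where \<psi>: "\<psi> \<in> Group.iso G ?T"
    using T.iso_set_sym by blast
  then have \<psi>_hom: "\<psi> \<in> hom G ?T" and \<psi>_image: "\<psi> ` carrier G = carrier ?T"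
    and \<psi>_inj: "inj_on \<psi> (carrier G)"
    by (auto simp: iso_iff)
  have \<psi>_closed: "\<psi> g \<in> carrier ?T" if "g \<in> carrier G" for g
    using \<psi>_image that by blast
  have all_\<psi>: "(\<forall>t\<in>carrier ?T. Q t) \<longleftrightarrow> (\<forall>g\<in>carrier G. Q (\<psi> g))" for Q
    using \<psi>_image by (metis image_iff)
  have "gluing_evolution ?X ?d ?z G (\<lambda>g. ?a (\<psi> g)) f"
  proof
    show "compact_space P.mtopology"
      by (rule P.compact)
    show "?a (\<psi> g) x \<in> ?X" if "g \<in> carrier G" "x \<in> ?X" for g x
      using P.element_image[OF \<psi>_closed] that by blast
    show "?a (\<psi> \<one>\<^bsub>G\<^esub>) x = x" if "x \<in> ?X" for x
      using P.id_eq_one that hom_one[OF \<psi>_hom G.is_group T.is_group] by (metis restrict_apply')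
    show "?a (\<psi> (g \<otimes>\<^bsub>G\<^esub> h)) x = ?a (\<psi> g) (?a (\<psi> h) x)"
      if "g \<in> carrier G" "h \<in> carrier G" "x \<in> ?X" for g h x
      using that P.composition_rule \<psi>_closed hom_mult[OF \<psi>_hom] by simp
    show "continuous_map P.mtopology P.mtopology (?a (\<psi> g))" if "g \<in> carrier G" for g
      by (rule P.continuous[OF \<psi>_closed[OF that]])
    show "?a (\<psi> g) ?z = ?z" if "g \<in> carrier G" for g
      by (rule P.zero_fixed[OF \<psi>_closed[OF that]])
    show "?z \<in> ?X"
      by (rule P.zero_in)
    show "expansive ?X ?d G (\<lambda>g. ?a (\<psi> g))"
      using tier_expansive[OF base_in] unfolding expansive_def all_\<psi> .
    show "\<exists>y\<in>?X. homoclinic ?d ?z G (\<lambda>g. ?a (\<psi> g)) y \<and> ?d x y < \<epsilon>" if x: "x \<in> ?X" "\<epsilon> > 0" for x \<epsilon>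
    proof -
      obtain y where y: "y \<in> ?X" "homoclinic ?d ?z ?T ?a y" "?d x y < \<epsilon>"
        using S(5)[unfolded weakly_dense_homoclinic_def, rule_format, OF base_in x] by (auto simp: tle)
      have "homoclinic ?d ?z G (\<lambda>g. ?a (\<psi> g)) y"
        unfolding homoclinic_def
      proof (intro allI impI)
        fix \<theta> :: real assume "\<theta> > 0"
        then obtain E where E: "finite E" "E \<subseteq> carrier ?T" "\<forall>t\<in>carrier ?T - E. ?d (?a t y) ?z < \<theta>"
          using homoclinicE[OF y(2)] by blast
        show "\<exists>E. finite E \<and> E \<subseteq> carrier G \<and> (\<forall>g\<in>carrier G - E. ?d (?a (\<psi> g) y) ?z < \<theta>)"
          using E \<psi>_closed finite_vimage_IntI[OF E(1) \<psi>_inj]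
          by (intro exI[of _ "\<psi> -` E \<inter> carrier G"]) auto
      qed
      with y show ?thesis by blast
    qed
    show "\<exists>\<delta>>0. \<exists>E. finite E \<and> E \<subseteq> carrier G \<and>
      (\<forall>p. (\<forall>g\<in>carrier G. p g \<in> ?X) \<and>
         (\<forall>g\<in>carrier G. \<forall>e\<in>E. p (e \<otimes>\<^bsub>G\<^esub> g) \<noteq> p g \<longrightarrow> ?d (?a (\<psi> g) (p g)) ?z < \<delta>) \<longrightarrow>
         (\<exists>y\<in>?X. \<forall>g\<in>carrier G. ?d (?a (\<psi> g) y) (?a (\<psi> g) (p g)) < \<epsilon>))" if "\<epsilon> > 0" for \<epsilon>
    proof -
      have "\<forall>\<epsilon>>0. \<exists>\<delta>>0. \<exists>E. finite E \<and> E \<subseteq> carrier ?T \<and>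
           (\<forall>(I :: 'h set) A x.
              small_designation ?X ?d ?z ?T ?a \<delta> E I A x \<and> (\<forall>i\<in>I. x i \<in> ?X) \<longrightarrow>
              (\<exists>y. realization ?X ?d ?a \<epsilon> I A x y))"
        using S(4)[unfolded weakly_gluing_def, rule_format, OF base_in]
        by (simp only: tle simp_thms)
      from this[rule_format, OF \<open>\<epsilon> > 0\<close>] obtain \<delta> E
        where E: "\<delta> > 0" "finite E" "E \<subseteq> carrier ?T"
          and glue: "\<forall>(I :: 'h set) A x.
            small_designation ?X ?d ?z ?T ?a \<delta> E I A x \<and> (\<forall>i\<in>I. x i \<in> ?X) \<longrightarrow>
            (\<exists>y. realization ?X ?d ?a \<epsilon> I A x y)"
        by (elim exE conjE) (rule that)
      have glue: "\<exists>y. realization ?X ?d ?a \<epsilon> I A x y"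
        if "small_designation ?X ?d ?z ?T ?a \<delta> E I A x" for I :: "'h set" and A x
        using glue[rule_format, of I A x] that by (simp add: small_designation_def designation_def)
      define E' where "E' = \<psi> -` E \<inter> carrier G"
      let ?inv = "inv_into (carrier G) \<psi>"
      have inv_\<psi>: "?inv (\<psi> g) = g" if "g \<in> carrier G" for g
        using \<psi>_inj that by (rule inv_into_f_f)
      have "\<exists>y\<in>?X. \<forall>g\<in>carrier G. ?d (?a (\<psi> g) y) (?a (\<psi> g) (p g)) < \<epsilon>"
        if p: "\<forall>g\<in>carrier G. p g \<in> ?X"
          and small: "\<forall>g\<in>carrier G. \<forall>e\<in>E'. p (e \<otimes>\<^bsub>G\<^esub> g) \<noteq> p g \<longrightarrow> ?d (?a (\<psi> g) (p g)) ?z < \<delta>"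
        for p
      proof -
        have "\<exists>y\<in>?X. \<forall>t\<in>carrier ?T. ?d (?a t y) (?a t (p (?inv t))) < \<epsilon>"
        proof (rule realization_of_assignment[OF T.is_group glue E(3)])
          show "p (?inv t) \<in> ?X" if "t \<in> carrier ?T" for t
            using that p all_\<psi>[of "\<lambda>t. p (?inv t) \<in> ?X"] inv_\<psi> by simp
          fix t e assume te: "t \<in> carrier ?T" "e \<in> E" "p (?inv (e \<otimes>\<^bsub>?T\<^esub> t)) \<noteq> p (?inv t)"
          obtain g k where gk: "t = \<psi> g" "g \<in> carrier G" "e = \<psi> k" "k \<in> carrier G"
            using te E(3) \<psi>_image by (metis image_iff subsetD)
          then have "?inv (e \<otimes>\<^bsub>?T\<^esub> t) = k \<otimes>\<^bsub>G\<^esub> g"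
            using hom_mult[OF \<psi>_hom, of k g] inv_\<psi>[of "k \<otimes>\<^bsub>G\<^esub> g"] by simp
          then show "?d (?a t (p (?inv t))) ?z < \<delta>"
            using small te gk inv_\<psi> by (auto simp: E'_def)
        qed
        then show ?thesis
          unfolding all_\<psi> using inv_\<psi> by simp
      qed
      moreover have "finite E'" "E' \<subseteq> carrier G"
        using finite_vimage_IntI[OF E(2) \<psi>_inj] by (auto simp: E'_def)
      ultimately show ?thesis
        using E(1) by (intro exI[of _ \<delta>] conjI exI[of _ E'] allI impI) simp_all
    qed
    have "\<forall>k. (f ^^ k) ` ?X \<subseteq> ?X"
      using S(3)[unfolded stabilizing_def, rule_format, OF base_in] by (simp only: tle simp_thms)
    from this[rule_format, of 1] have f_closed: "f x \<in> ?X" if "x \<in> ?X" for x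
      using that by auto
    have "continuous_map amb.mtopology amb.mtopology f"
      using S(2) by (simp add: evolution_def ambient_top_def)
    then show "continuous_map P.mtopology P.mtopology f"
      unfolding mtopology_submetric using f_closed
      by (auto simp: continuous_map_in_subtopology continuous_map_from_subtopology)
    show "f (?a (\<psi> g) x) = ?a (\<psi> g) (f x)" if "g \<in> carrier G" "x \<in> ?X" for g x
      using S(2) tle f_closed that \<psi>_closed tmap_id[OF base_in]
      unfolding evolution_def by metis
    show "\<exists>N. \<forall>n\<ge>N. ?d ((f ^^ n) x) ?z < \<epsilon>" if "x \<in> ?X" "\<epsilon> > 0" for x \<epsilon>
      using nil that subset
      by (simp add: asymptotically_nilpotent_def ambient_top_def amb.limit_metric_sequentially)
        (metis subsetD)
  qed
  from exI[of "\<lambda>act. gluing_evolution ?X ?d ?z G act f", OF this] show ?thesis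
    .
qed

theorem proposition9p4:
  fixes G :: "'g monoid"
  assumes "group G"
    and "locally_group (nil_rigid (class_C2 :: 'g std_etds set)) G \<or>
         locally_group (nil_rigid (class_C4 :: 'g std_etds set)) G \<or>
         (locally_group (nil_rigid (class_C3 :: 'g std_etds set)) G \<and>
          locally_group residually_finite G)"
  shows "nil_rigid (class_C4 :: ('x, 't, 'h) etds set) G"
  unfolding nil_rigid_def
proof (intro ballI, clarify)
  fix S :: "('x, 't, 'h) tds" and f t
  assume C4: "(S, f) \<in> class_C4" and iso: "tgroup S (tbase S) \<cong> G"
    and nil: "asymptotically_nilpotent S f" and t: "t \<in> tiers S"
  obtain act where "gluing_evolution (tspace S (tbase S)) (tdist S) (tzero S) G act f"
    using single_tier_gluing_evolution[OF C4 iso assms(1) nil] by blast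
  from gluing_evolution.nilpotent_if_locally_nil_rigid[OF this assms(2)]
  have "nilpotent_on S f (tspace S (tbase S))"
    by (simp add: nilpotent_on_def)
  then show "nilpotent_on S f (tspace S t)"
    using C4 t by (auto simp: class_C4_def)
qed

end
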